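(* Let $H>0$ and let $Y=(Y_t)_{t\geq 0}$ be a real-valued process with càdlàg paths which is self-similar with index $H$. Assume that $|Y_1|$ has a density belonging to $\mathfrak{M}_{(0,\infty)}$. Let $T\geq 0$ be a random time with density $f_T$, independent of $Y$, and let $\hat f_n$ be the estimator defined in the context. Let $\beta\in(0,\pi)$ and $0\leq a<b$, and suppose $f_T\in\mathcal{C}(\beta,a,b)$. Then for every $\gamma\in(\max\{a,1-H\},b)$ there is a constant $C>0$, not depending on $x$ or $n$, such that $$\left|f_T(x)-\mathbb{E}[\hat f_n(x)]\right|\leq C\,x^{-\gamma}e^{-\beta g_n}\quad\text{for all }x>0\text{ and all }n.$$
   Context: For $0\leq a<b$, $\mathfrak{M}_{(a,b)}$ denotes the set of measurable $f:(0,\infty)\to\mathbb{C}$ with $\int_0^\infty|f(x)|x^{c-1}\,dx<\infty$ for every $c\in(a,b)$. For such $f$ the Mellin transform is $\mathcal{M}[f](s)=\int_0^\infty f(x)x^{s-1}\,dx$ for $\operatorname{Re}(s)\in(a,b)$; for a nonnegative random variable $X$ with density $f_X$ we write $\mathcal{M}[X]:=\mathcal{M}[f_X]$, i.e. $\mathcal{M}[X](s)=\mathbb{E}[X^{s-1}]$. A process $Y$ is self-similar with index $H$ if for every $c>0$ the finite-dimensional distributions of $(Y_{ct})_{t\geq0}$ and $(c^HY_t)_{t\geq0}$ coincide. For $\beta\in(0,\pi)$ let $S_\beta=\{z\in\mathbb{C}\setminus\{0\}:|\arg z|\leq\beta\}$, and let $\mathcal{C}(\beta,a,b)$ be the set of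 $f\in\mathfrak{M}_{(a,b)}$ for which there is a holomorphic $\tilde f:S_\beta\to\mathbb{C}$ with $\tilde f|_{(0,\infty)}=f$, $|\tilde f(z)|=O(|z|^{-a})$ as $z\to0$ and $|\tilde f(z)|=O(|z|^{-b})$ as $|z|\to\infty$ (within $S_\beta$). Estimator: let $X_1,\dots,X_n$ be i.i.d. copies of $Y_T$, let $(g_n)$ be positive reals with $g_n\to\infty$, and let $\gamma\in(\max\{1-H,a\},b)$ where $f_T\in\mathfrak{M}_{(a,b)}$. With $\mathcal{M}_n[|Y_T|](s)=\frac1n\sum_{k=1}^n|X_k|^{s-1}$, define for $x>0$ $$\hat f_n(x)=\frac{1}{2\pi}\int_{-g_n}^{g_n}\frac{\mathcal{M}_n[|Y_T|]\big(\frac{\gamma+H-1+iv}{H}\big)}{\mathcal{M}[|Y_1|]\big(\frac{\gamma+H-1+iv}{H}\big)}\,x^{-\gamma-iv}\,dv,$$ where it is assumed that $\mathcal{M}[|Y_1|]$ does not vanish on the line of integration. *)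

theory Defs
  imports "HOL-Analysis.Analysis" "HOL-Probability.Probability"
begin

definition mellin_class :: "real set \<Rightarrow> (real \<Rightarrow> complex) \<Rightarrow> bool" where
  "mellin_class I f \<longleftrightarrow>
     (\<forall>c\<in>I. set_integrable lborel {0<..} (\<lambda>x. f x * complex_of_real (x powr (c - 1))))"

definition mellin :: "(real \<Rightarrow> complex) \<Rightarrow> complex \<Rightarrow> complex" where
  "mellin f s = set_lebesgue_integral lborel {0<..} (\<lambda>x. f x * (complex_of_real x) powr (s - 1))"

definition sector :: "real \<Rightarrow> complex set" where
  "sector \<beta> = {z. z \<noteq> 0 \<and> \<bar>Arg z\<bar> \<le> \<beta>}"

definition sector_class :: "real \<Rightarrow> real \<Rightarrow> real \<Rightarrow> (real \<Rightarrow> complex) \<Rightarrow> bool" where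
  "sector_class \<beta> a b f \<longleftrightarrow> mellin_class {a<..<b} f \<and>
     (\<exists>F. F holomorphic_on sector \<beta> \<and> (\<forall>x>0. F (complex_of_real x) = f x) \<and>
          (\<exists>C r. r > 0 \<and> (\<forall>z\<in>sector \<beta>. cmod z \<le> r \<longrightarrow> cmod (F z) \<le> C * cmod z powr (- a))) \<and>
          (\<exists>C R. \<forall>z\<in>sector \<beta>. cmod z \<ge> R \<longrightarrow> cmod (F z) \<le> C * cmod z powr (- b)))"

definition self_similar :: "'a measure \<Rightarrow> (real \<Rightarrow> 'a \<Rightarrow> real) \<Rightarrow> real \<Rightarrow> bool" where
  "self_similar M Y H \<longleftrightarrow>
     (\<forall>c>0. \<forall>J. finite J \<and> J \<subseteq> {0..} \<longrightarrow>
        distr M (PiM J (\<lambda>_. borel)) (\<lambda>\<omega>. \<lambda>t\<in>J. Y (c * t) \<omega>) =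
        distr M (PiM J (\<lambda>_. borel)) (\<lambda>\<omega>. \<lambda>t\<in>J. c powr H * Y t \<omega>))"

definition cadlag :: "(real \<Rightarrow> real) \<Rightarrow> bool" where
  "cadlag p \<longleftrightarrow> (\<forall>t\<ge>0. continuous (at_right t) p) \<and>
                 (\<forall>t>0. \<exists>l. (p \<longlongrightarrow> l) (at_left t))"

definition emp_mellin :: "(nat \<Rightarrow> 'a \<Rightarrow> real) \<Rightarrow> nat \<Rightarrow> 'a \<Rightarrow> complex \<Rightarrow> complex" where
  "emp_mellin X n \<omega> s = (1 / of_nat n) * (\<Sum>k=1..n. (complex_of_real \<bar>X k \<omega>\<bar>) powr (s - 1))"

text \<open>The estimator hat f_n(x); f1 is the density of |Y_1|.\<close>
definition estimator ::
  "(nat \<Rightarrow> 'a \<Rightarrow> real) \<Rightarrow> (real \<Rightarrow> complex) \<Rightarrow> real \<Rightarrow> real \<Rightarrow> (nat \<Rightarrow> real) \<Rightarrow> nat \<Rightarrow> real \<Rightarrow> 'a \<Rightarrow> complex" where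
  "estimator X f1 H \<gamma> g n x \<omega> =
     (1 / (2 * of_real pi)) *
     set_lebesgue_integral lborel {- g n .. g n}
       (\<lambda>v. let s = (complex_of_real (\<gamma> + H - 1) + \<i> * of_real v) / of_real H in
            emp_mellin X n \<omega> s / mellin f1 s * (complex_of_real x) powr (- of_real \<gamma> - \<i> * of_real v))"

end

theory Submission
  imports Defs "HOL-Complex_Analysis.Complex_Analysis"
begin

text \<open>
  Conditioning on \<open>T\<close> and self-similarity give \<open>|Y_T| = T^H |Y_1|\<close> in law, with independent factors.
  Hence \<open>E |X_k|^(s-1) = M[f_T](\<gamma> + iv) M[|Y_1|](s)\<close> for \<open>s = (\<gamma> + H - 1 + iv) / H\<close>, the denominator of the
  estimator cancels, and its expectation is the Mellin inversion integral of \<open>f_T\<close> truncated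
  to \<open>|v| \<le> g_n\<close>. In the coordinate \<open>u = ln x\<close> the sector becomes a strip; moving the line of integration
  to its upper or lower edge gives \<open>|M[f_T](\<gamma> + iv)| \<le> K exp (-\<beta> |v|)\<close>. Thus the inversion formula
  holds, and its tail beyond \<open>g_n\<close> is of order \<open>x^(-\<gamma>) exp (-\<beta> g_n)\<close>.
\<close>

subsection \<open>Shifting the line of integration in a strip\<close>

text \<open>Three obstacles shape the details. The extension of \<open>f_T\<close> is holomorphic
  only relative to the closed sector, so an edge of the strip has no neighbourhood to work in; the
  contour shift therefore uses a primitive on the closed strip, with all derivatives taken within
  it. The bound is claimed at every \<open>x\<close>, so inversion almost everywhere is not enough;
  pointwise inversion is extracted from Levy's formula for probability measures, which applies
  because \<open>exp (\<gamma> u) f_T (exp u)\<close> is nonnegative and can be normalised. Finally,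
  \<open>Y t \<omega>\<close> is not assumed jointly measurable in \<open>(t, \<omega>)\<close>, so
  conditioning on \<open>T\<close> is not a direct use of Fubini: \<open>T\<close> is approximated
  from the right by countably valued times, and right-continuity of the paths carries the result
  over. The condition \<open>\<gamma> > 1 - H\<close> says that \<open>Re s > 0\<close>, which is
  the strip where the transform of \<open>|Y_1|\<close> converges.\<close>

lemma integrable_exp_tail:
  fixes c g :: real
  assumes "c > 0"
  shows "set_integrable lborel {g..} (\<lambda>x. exp (- c * x))"
    and "(LINT x:{g..}|lborel. exp (- c * x)) = exp (- c * g) / c"
proof -
  have hi: "((\<lambda>x. exp (- c * x)) has_integral exp (- c * g) / c) {g..}"
    using has_integral_exp_minus_to_infinity[OF assms, of g] by simp
  then have "(\<lambda>x. exp (- c * x)) absolutely_integrable_on {g..}"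
    by (intro nonnegative_absolutely_integrable_1) (auto simp: integrable_on_def)
  then show si: "set_integrable lborel {g..} (\<lambda>x. exp (- c * x))"
    unfolding set_integrable_def by (subst (asm) integrable_completion) auto
  show "(LINT x:{g..}|lborel. exp (- c * x)) = exp (- c * g) / c"
    using set_borel_integral_eq_integral(2)[OF si] hi by (simp add: integral_unique)
qed

text \<open>There is no sign condition on \<open>g\<close>: for negative \<open>g\<close> the two
  half-lines overlap, which only enlarges the sum of \<open>k\<close> and its reflection. This is
  why the value is bounded and not computed, and why a negative threshold yields integrability on
  the whole line.\<close>

lemma integrable_exp_abs_tail:
  fixes c g :: real
  assumes "c > 0"
  shows "set_integrable lborel {x. g < \<bar>x\<bar>} (\<lambda>x. exp (- c * \<bar>x\<bar>))"
    and "(LINT x:{x. g < \<bar>x\<bar>}|lborel. exp (- c * \<bar>x\<bar>)) \<le> 2 * exp (- c * g) / c"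
proof -
  define k where "k = (\<lambda>x. indicator {g..} x *\<^sub>R exp (- c * x))"
  have k: "integrable lborel k" "integral\<^sup>L lborel k = exp (- c * g) / c"
    using integrable_exp_tail[OF assms, of g] by (auto simp: k_def set_integrable_def set_lebesgue_integral_def)
  have k': "integrable lborel (\<lambda>x. k (- x))" "(LINT x|lborel. k (- x)) = exp (- c * g) / c"
    using lborel_integrable_real_affine[OF k(1), of "-1" 0] lborel_integral_real_affine[of "-1" k 0] k(2)
    by auto
  have le: "indicator {x. g < \<bar>x\<bar>} x *\<^sub>R exp (- c * \<bar>x\<bar>) \<le> k x + k (- x)" for x
    by (auto simp: k_def indicator_def abs_if intro: add_increasing add_increasing2)
  have int: "integrable lborel (\<lambda>x. k x + k (- x))"
    using k k' by auto
  show si: "set_integrable lborel {x. g < \<bar>x\<bar>} (\<lambda>x. exp (- c * \<bar>x\<bar>))"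
    unfolding set_integrable_def
  proof (rule Bochner_Integration.integrable_bound[OF int])
    show "AE x in lborel. norm (indicator {x. g < \<bar>x\<bar>} x *\<^sub>R exp (- c * \<bar>x\<bar>)) \<le> norm (k x + k (- x))"
      using le by (intro AE_I2) (smt (verit) exp_gt_zero indicator_pos_le mult_nonneg_nonneg real_norm_def real_scaleR_def)
  qed simp
  have "(LINT x:{x. g < \<bar>x\<bar>}|lborel. exp (- c * \<bar>x\<bar>)) \<le> (LINT x|lborel. k x + k (- x))"
    unfolding set_lebesgue_integral_def
    by (rule integral_mono[OF si[unfolded set_integrable_def] int le])
  also have "\<dots> = 2 * exp (- c * g) / c"
    using k k' by simp
  finally show "(LINT x:{x. g < \<bar>x\<bar>}|lborel. exp (- c * \<bar>x\<bar>)) \<le> 2 * exp (- c * g) / c" .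
qed

lemma integrable_exp_abs:
  fixes c :: real
  assumes "c > 0"
  shows "integrable lborel (\<lambda>x. exp (- c * \<bar>x\<bar>))"
proof -
  have "{x::real. -1 < \<bar>x\<bar>} = UNIV" by auto
  with integrable_exp_abs_tail(1)[OF assms, of "-1"] show ?thesis
    by (simp add: set_integrable_def)
qed

lemma LINT_lborel_limit_symmetric:
  fixes f :: "real \<Rightarrow> complex"
  assumes "integrable lborel f"
  shows "(\<lambda>n. LINT x:{- real n..real n}|lborel. f x) \<longlonglongrightarrow> integral\<^sup>L lborel f"
  unfolding set_lebesgue_integral_def
proof (rule integral_dominated_convergence[where w="\<lambda>x. norm (f x)"])
  show "AE x in lborel. (\<lambda>n. indicator {- real n..real n} x *\<^sub>R f x) \<longlonglongrightarrow> f x"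
  proof (intro AE_I2 tendsto_eventually)
    fix x :: real
    obtain N where "\<bar>x\<bar> \<le> real N" using real_arch_simple by blast
    then show "\<forall>\<^sub>F n in sequentially. indicator {- real n..real n} x *\<^sub>R f x = f x"
      by (intro eventually_sequentiallyI[of N]) (auto simp: indicator_def)
  qed
qed (use assms in \<open>auto simp: indicator_def borel_measurable_integrable\<close>)

text \<open>With a primitive \<open>P\<close>, the difference of the truncated integrals over two
  horizontal lines equals the difference of the increments of \<open>P\<close> along the two
  vertical sides. Each side has length at most \<open>\<beta>\<close> and carries an integrand of
  size \<open>exp (- \<delta> n)\<close>.\<close>

lemma strip_contour_shift:
  fixes G :: "complex \<Rightarrow> complex"
  assumes hol: "G holomorphic_on {w. \<bar>Im w\<bar> \<le> \<beta>}" and \<delta>: "\<delta> > 0"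
    and bd: "\<And>w. \<bar>Im w\<bar> \<le> \<beta> \<Longrightarrow> cmod (G w) \<le> K * exp (- \<delta> * \<bar>Re w\<bar>)"
    and \<theta>: "\<bar>\<theta>\<bar> \<le> \<beta>"
  shows "integrable lborel (\<lambda>u. G (Complex u \<theta>))"
    and "(LINT u|lborel. G (Complex u \<theta>)) = (LINT u|lborel. G (of_real u))"
proof -
  define S where "S = {w. \<bar>Im w\<bar> \<le> \<beta>}"
  have S_eq: "S = {w. Im w \<ge> - \<beta>} \<inter> {w. Im w \<le> \<beta>}" by (auto simp: S_def)
  have conv: "convex S"
    unfolding S_eq by (intro convex_Int convex_halfspace_Im_ge convex_halfspace_Im_le)
  have cont: "continuous_on S G"
    using hol holomorphic_on_imp_continuous_on unfolding S_def by blast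
  \<comment> \<open>Differentiability in the interior and continuity up to the boundary suffice for
    a primitive on a convex set, so the extreme case \<open>\<theta> = \<plusminus>\<beta>\<close>
    is covered although \<open>G\<close> need not extend beyond the strip.\<close>
  obtain P where P: "\<And>x. x \<in> S \<Longrightarrow> (P has_field_derivative G x) (at x within S)"
  proof (rule holomorphic_convex_primitive[OF conv _ cont, of "{}"])
    fix x assume "x \<in> interior S - {}"
    then show "G field_differentiable at x"
      using hol holomorphic_on_imp_differentiable_at[of G "interior S" x] holomorphic_on_subset[OF hol]
      by (metis DiffD1 S_def interior_subset open_interior)
  qed auto
  have cont_line: "continuous_on UNIV (\<lambda>u. G (Complex u t))" if "\<bar>t\<bar> \<le> \<beta>" for t
    by (rule continuous_on_compose2[OF cont])
       (auto simp: S_def that Complex_eq intro!: continuous_intros)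
  have int_line: "integrable lborel (\<lambda>u. G (Complex u t))" if "\<bar>t\<bar> \<le> \<beta>" for t
  proof (rule Bochner_Integration.integrable_bound)
    show "integrable lborel (\<lambda>u. K * exp (- \<delta> * \<bar>u\<bar>))"
      using integrable_exp_abs[OF \<delta>] by simp
    show "(\<lambda>u. G (Complex u t)) \<in> borel_measurable lborel"
      using borel_measurable_continuous_onI[OF cont_line[OF that]] by simp
    show "AE u in lborel. norm (G (Complex u t)) \<le> norm (K * exp (- \<delta> * \<bar>u\<bar>))"
    proof (intro AE_I2)
      fix u
      show "norm (G (Complex u t)) \<le> norm (K * exp (- \<delta> * \<bar>u\<bar>))"
        using bd[of "Complex u t"] that by simp
    qed
  qed
  show "integrable lborel (\<lambda>u. G (Complex u \<theta>))" by (rule int_line[OF \<theta>])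
  have fin: "(LINT u:{- real n..real n}|lborel. G (Complex u t)) = P (Complex n t) - P (Complex (- real n) t)"
    if t: "\<bar>t\<bar> \<le> \<beta>" for t n
  proof -
    have "((\<lambda>u. G (Complex u t)) has_integral P (Complex n t) - P (Complex (- real n) t)) {- real n..real n}"
    proof (rule fundamental_theorem_of_calculus)
      fix u assume "u \<in> {- real n..real n}"
      have "((P \<circ> (\<lambda>u. Complex u t)) has_vector_derivative 1 * G (Complex u t)) (at u within {- real n..real n})"
      proof (rule field_vector_diff_chain_within)
        have "((\<lambda>u. of_real u + \<i> * of_real t :: complex) has_vector_derivative 1) (at u within {- real n..real n})"
          by (auto intro!: derivative_eq_intros)
        then show "((\<lambda>u. Complex u t) has_vector_derivative 1) (at u within {- real n..real n})"
          by (simp add: Complex_eq)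
        show "(P has_field_derivative G (Complex u t)) (at (Complex u t) within (\<lambda>u. Complex u t) ` {- real n..real n})"
          by (rule DERIV_subset[OF P]) (use t in \<open>auto simp: S_def\<close>)
      qed
      then show "((\<lambda>u. P (Complex u t)) has_vector_derivative G (Complex u t)) (at u within {- real n..real n})"
        by (simp add: o_def)
    qed auto
    moreover have "set_integrable lborel {- real n..real n} (\<lambda>u. G (Complex u t))"
      unfolding set_integrable_def by (rule integrable_mult_indicator) (auto intro: int_line[OF t])
    ultimately show ?thesis
      using set_borel_integral_eq_integral(2) integral_unique by metis
  qed
  have side: "cmod (P (Complex r \<theta>) - P (Complex r 0)) \<le> K * exp (- \<delta> * \<bar>r\<bar>) * \<bar>\<theta>\<bar>" for r
  proof -
    \<comment> \<open>The cross-section of the strip at abscissa \<open>r\<close> is convex and the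
      bound on \<open>G\<close> is constant there, so the mean value inequality applies to
      \<open>P\<close>.\<close>
    define L where "L = S \<inter> {w. Re w = r}"
    have "convex L"
    proof -
      have "L = S \<inter> ({w. Re w \<ge> r} \<inter> {w. Re w \<le> r})" by (auto simp: L_def)
      then show ?thesis
        by (simp add: convex_Int conv convex_halfspace_Re_ge convex_halfspace_Re_le)
    qed
    have "cmod (P (Complex r \<theta>) - P (Complex r 0)) \<le> K * exp (- \<delta> * \<bar>r\<bar>) * cmod (Complex r \<theta> - Complex r 0)"
    proof (rule field_differentiable_bound[OF \<open>convex L\<close>, where f' = G])
      show "(P has_field_derivative G z) (at z within L)" if "z \<in> L" for z
        by (rule DERIV_subset[OF P]) (use that in \<open>auto simp: L_def\<close>)
      show "cmod (G z) \<le> K * exp (- \<delta> * \<bar>r\<bar>)" if "z \<in> L" for z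
        using bd[of z] that by (auto simp: L_def S_def)
    qed (use \<theta> in \<open>auto simp: L_def S_def\<close>)
    also have "cmod (Complex r \<theta> - Complex r 0) = \<bar>\<theta>\<bar>"
      by (simp add: cmod_def)
    finally show ?thesis .
  qed
  have z: "\<bar>0::real\<bar> \<le> \<beta>" using \<theta> by auto
  let ?I = "\<lambda>t n. LINT u:{- real n..real n}|lborel. G (Complex u t)"
  have "(\<lambda>n. ?I \<theta> n - ?I 0 n) \<longlonglongrightarrow> (LINT u|lborel. G (Complex u \<theta>)) - (LINT u|lborel. G (Complex u 0))"
    by (intro tendsto_diff LINT_lborel_limit_symmetric int_line \<theta> z)
  moreover have "(\<lambda>n. ?I \<theta> n - ?I 0 n) \<longlonglongrightarrow> 0"
  proof (rule Lim_null_comparison)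
    show "\<forall>\<^sub>F n in sequentially. norm (?I \<theta> n - ?I 0 n) \<le> 2 * (K * exp (- \<delta> * real n) * \<bar>\<theta>\<bar>)"
    proof (intro always_eventually allI)
      fix n
      have "?I \<theta> n - ?I 0 n = (P (Complex n \<theta>) - P (Complex n 0)) - (P (Complex (- real n) \<theta>) - P (Complex (- real n) 0))"
        by (simp add: fin[OF \<theta>] fin[OF z])
      then have "norm (?I \<theta> n - ?I 0 n) \<le> cmod (P (Complex n \<theta>) - P (Complex n 0)) + cmod (P (Complex (- real n) \<theta>) - P (Complex (- real n) 0))"
        by (metis norm_triangle_ineq4)
      with side[of "real n"] side[of "- real n"]
      show "norm (?I \<theta> n - ?I 0 n) \<le> 2 * (K * exp (- \<delta> * real n) * \<bar>\<theta>\<bar>)" by simp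
    qed
    have "(\<lambda>n. exp (- \<delta>) ^ n) \<longlonglongrightarrow> 0"
      by (rule LIMSEQ_realpow_zero) (use \<delta> in auto)
    then have "(\<lambda>n. exp (- \<delta> * real n)) \<longlonglongrightarrow> 0"
      by (simp only: exp_of_nat2_mult)
    from tendsto_mult_left[OF this, of "2 * K * \<bar>\<theta>\<bar>"]
    show "(\<lambda>n. 2 * (K * exp (- \<delta> * real n) * \<bar>\<theta>\<bar>)) \<longlonglongrightarrow> 0"
      by (simp add: mult_ac)
  qed
  ultimately have "(LINT u|lborel. G (Complex u \<theta>)) - (LINT u|lborel. G (Complex u 0)) = 0"
    using LIMSEQ_unique by blast
  then show "(LINT u|lborel. G (Complex u \<theta>)) = (LINT u|lborel. G (of_real u))"
    by (simp add: complex_of_real_def)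
qed

section \<open>The logarithmic substitution on the positive half-line\<close>

lemma integral_exp_substitution:
  fixes f :: "real \<Rightarrow> complex"
  assumes f: "set_integrable lborel {0<..} f"
  shows "integrable lborel (\<lambda>u. exp u *\<^sub>R f (exp u))"
    and "(LINT u|lborel. exp u *\<^sub>R f (exp u)) = (LINT x:{0<..}|lborel. f x)"
proof -
  \<comment> \<open>The change of variables below takes place on the completed measure, so Borel
    measurability of the transformed integrand has to be secured separately. Only the restriction of
    \<open>f\<close> to the half-line is known to be measurable, and \<open>exp\<close> never leaves
    it.\<close>
  have [measurable]: "(\<lambda>x. indicator {0<..} x *\<^sub>R f x) \<in> borel_measurable borel"
    using borel_measurable_integrable[OF f[unfolded set_integrable_def]] by simp
  have "(\<lambda>u. indicator {0<..} (exp u) *\<^sub>R f (exp u)) \<in> borel_measurable borel"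
    by (rule measurable_compose[of exp borel borel "\<lambda>x. indicator {0<..} x *\<^sub>R f x"]) measurable
  moreover have "indicator {0<..} (exp u) *\<^sub>R f (exp u) = f (exp u)" for u :: real by simp
  ultimately have "(\<lambda>u. f (exp u)) \<in> borel_measurable borel" by (simp only:)
  then have m: "(\<lambda>u. exp u *\<^sub>R f (exp u)) \<in> borel_measurable borel"
    by (intro borel_measurable_scaleR borel_measurable_exp) simp_all
  have "f absolutely_integrable_on {0<..}"
    using f unfolding set_integrable_def by (subst integrable_completion) (auto dest: borel_measurable_integrable)
  moreover have "integral {0<..} f = (LINT x:{0<..}|lborel. f x)"
    using set_borel_integral_eq_integral(2)[OF f] by simp
  moreover have "exp ` UNIV = {0::real<..}"
    by (auto simp: image_iff) (metis exp_ln)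
  ultimately have "(\<lambda>u. \<bar>exp u\<bar> *\<^sub>R f (exp u)) absolutely_integrable_on UNIV \<and>
      integral UNIV (\<lambda>u. \<bar>exp u\<bar> *\<^sub>R f (exp u)) = (LINT x:{0<..}|lborel. f x)"
    by (subst has_absolute_integral_change_of_variables_real) (auto intro!: derivative_eq_intros simp: inj_on_def)
  then have ai: "(\<lambda>u. exp u *\<^sub>R f (exp u)) absolutely_integrable_on UNIV"
    and eq: "integral UNIV (\<lambda>u. exp u *\<^sub>R f (exp u)) = (LINT x:{0<..}|lborel. f x)"
    by auto
  show i: "integrable lborel (\<lambda>u. exp u *\<^sub>R f (exp u))"
    using ai m by (simp add: set_integrable_def integrable_completion)
  show "(LINT u|lborel. exp u *\<^sub>R f (exp u)) = (LINT x:{0<..}|lborel. f x)"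
    using set_borel_integral_eq_integral(2)[of UNIV "\<lambda>u. exp u *\<^sub>R f (exp u)"] i eq
    by (simp add: set_integrable_def set_lebesgue_integral_def)
qed

subsection \<open>Fourier inversion for nonnegative functions\<close>

text \<open>Dividing by the total mass \<open>Z\<close> turns \<open>h\<close> into a probability
  density with characteristic function \<open>\<phi> / Z\<close>, to which Levy's inversion formula
  applies. Integrability of \<open>\<phi>\<close> upgrades the symmetric limit in that formula to an
  absolutely convergent integral.\<close>

lemma fourier_increment_nonneg:
  fixes h :: "real \<Rightarrow> real" and \<phi> :: "real \<Rightarrow> complex"
  assumes nonneg: "\<And>x. 0 \<le> h x" and int: "integrable lborel h"
    and \<phi>: "\<And>t. \<phi> t = (CLINT x|lborel. complex_of_real (h x) * iexp (t * x))"
    and int\<phi>: "integrable lborel \<phi>" and yz: "y \<le> z"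
  shows "complex_of_real (LINT x:{y..z}|lborel. h x) =
         1 / (2 * pi) * (CLINT t|lborel. (iexp (-(t * y)) - iexp (-(t * z))) / (\<i> * t) * \<phi> t)"
proof (cases "(LINT x|lborel. h x) = 0")
  \<comment> \<open>Zero mass cannot be normalised; here \<open>h\<close> vanishes almost everywhere
    and both sides are 0.\<close>
  case True
  then have ae: "AE x in lborel. h x = 0"
    using integral_nonneg_eq_0_iff_AE[OF int] nonneg by simp
  have "\<phi> t = 0" for t
    unfolding \<phi> by (rule integral_eq_zero_AE) (use ae in auto)
  moreover have "(LINT x:{y..z}|lborel. h x) = 0"
    unfolding set_lebesgue_integral_def by (rule integral_eq_zero_AE) (use ae in auto)
  ultimately show ?thesis by simp
next
  case False
  define Z where "Z = (LINT x|lborel. h x)"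
  have Z: "Z > 0" unfolding Z_def
    using False integral_nonneg_AE[of h lborel] nonneg by (simp add: less_eq_real_def)
  define M where "M = density lborel (\<lambda>x. ennreal (h x / Z))"
  have [measurable]: "h \<in> borel_measurable borel"
    using borel_measurable_integrable[OF int] by simp
  have nn: "0 \<le> h x / Z" for x using nonneg Z by simp
  have emeas: "emeasure M A = ennreal (LINT x:A|lborel. h x / Z)" if [measurable]: "A \<in> sets borel" for A
  proof -
    have "emeasure M A = (\<integral>\<^sup>+ x. ennreal (indicator A x * (h x / Z)) \<partial>lborel)"
      unfolding M_def by (subst emeasure_density) (auto intro!: nn_integral_cong simp: indicator_def)
    also have "\<dots> = ennreal (LINT x|lborel. indicator A x * (h x / Z))"
      using integrable_mult_indicator[of A lborel "\<lambda>x. h x / Z"] int nonneg Z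
      by (intro nn_integral_eq_integral) (auto simp: less_imp_le)
    finally show ?thesis by (simp add: set_lebesgue_integral_def)
  qed
  have "emeasure M (space M) = 1"
    using emeas[of UNIV] Z by (simp add: M_def set_lebesgue_integral_def flip: Z_def)
  then interpret M: real_distribution M
    by (auto simp: real_distribution_def real_distribution_axioms_def M_def intro!: prob_spaceI)
  have meas: "measure M A = (LINT x:A|lborel. h x / Z)" if "A \<in> sets borel" for A
    using emeas[OF that] Z nonneg integral_nonneg_AE[of "\<lambda>x. indicator A x * h x" lborel]
    by (simp add: measure_def set_lebesgue_integral_def)
  \<comment> \<open>Levy's formula requires that neither endpoint is an atom.\<close>
  have sing: "measure M {x} = 0" for x
  proof -
    have "AE u in lborel. indicator {x} u *\<^sub>R (h u / Z) = 0"
      using AE_lborel_singleton[of x] by eventually_elim simp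
    then have "(LINT u:{x}|lborel. h u / Z) = 0"
      unfolding set_lebesgue_integral_def by (rule integral_eq_zero_AE)
    then show ?thesis by (subst meas) auto
  qed
  have char: "char M t = \<phi> t / Z" for t
  proof -
    have "char M t = (CLINT x|lborel. (h x / Z) *\<^sub>R iexp (t * x))"
      unfolding char_def M_def using nn by (subst integral_density) auto
    also have "\<dots> = (CLINT x|lborel. complex_of_real (h x) * iexp (t * x) / Z)"
      by (simp add: scaleR_conv_of_real)
    also have "\<dots> = \<phi> t / Z"
      unfolding \<phi> by (rule integral_divide_zero)
    finally show ?thesis .
  qed
  have m\<phi>[measurable]: "\<phi> \<in> borel_measurable borel"
    using borel_measurable_integrable[OF int\<phi>] by simp
  let ?F = "\<lambda>t. (iexp (-(t * y)) - iexp (-(t * z))) / (\<i> * t)"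
  \<comment> \<open>The increment of \<open>iexp\<close> is at most
    \<open>\<bar>t\<bar> (z - y)\<close>, which absorbs the denominator. At \<open>t = 0\<close> the
    quotient is 0 by the convention for division.\<close>
  have F_bd: "cmod (?F t) \<le> z - y" for t
    using Levy_Inversion_aux2[of "-z" "-y" t] yz by (cases "t = 0") (auto simp: algebra_simps)
  have F_int: "integrable lborel (\<lambda>t. ?F t * \<phi> t)"
  proof (rule Bochner_Integration.integrable_bound)
    show "integrable lborel (\<lambda>t. (z - y) * cmod (\<phi> t))" using int\<phi> by simp
    show "AE t in lborel. norm (?F t * \<phi> t) \<le> norm ((z - y) * cmod (\<phi> t))"
    proof (rule AE_I2)
      fix t
      have "norm (?F t * \<phi> t) \<le> (z - y) * cmod (\<phi> t)"
        unfolding norm_mult by (intro mult_right_mono F_bd) simp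
      then show "norm (?F t * \<phi> t) \<le> norm ((z - y) * cmod (\<phi> t))"
        by (metis abs_ge_self order_trans real_norm_def)
    qed
  qed measurable
  have L: "(\<lambda>n::nat. 1 / (2 * pi) * (CLBINT t=- real n..real n. ?F t * char M t)) \<longlonglongrightarrow> measure M {y<..z}"
    using M.Levy_Inversion[OF yz sing sing] by simp
  have "(\<lambda>n::nat. CLBINT t=- real n..real n. ?F t * char M t) \<longlonglongrightarrow> (CLINT t|lborel. ?F t * char M t)"
  proof -
    have F_int': "integrable lborel (\<lambda>t. ?F t * char M t)"
      using F_int unfolding char times_divide_eq_right by (rule integrable_divide_zero)
    have "(CLBINT t=- real n..real n. ?F t * char M t) = (CLBINT t:{-real n..real n}. ?F t * char M t)" for n :: nat
      using interval_integral_Icc[of "- real n" "real n" "\<lambda>t. ?F t * char M t"] by simp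
    with LINT_lborel_limit_symmetric[OF F_int'] show ?thesis by simp
  qed
  then have "(\<lambda>n::nat. 1 / (2 * pi) * (CLBINT t=- real n..real n. ?F t * char M t)) \<longlonglongrightarrow> 
     1 / (2 * pi) * (CLINT t|lborel. ?F t * char M t)"
    by (intro tendsto_mult tendsto_const)
  from LIMSEQ_unique[OF L this]
  have "complex_of_real (measure M {y<..z}) = 1 / (2 * pi) * (CLINT t|lborel. ?F t * \<phi> t / Z)"
    unfolding char by (simp add: o_def)
  also have "(CLINT t|lborel. ?F t * \<phi> t / Z) = (CLINT t|lborel. ?F t * \<phi> t) / Z"
    by (rule integral_divide_zero)
  finally have "complex_of_real (measure M {y<..z}) = 1 / (2 * pi) * ((CLINT t|lborel. ?F t * \<phi> t) / Z)" .
  moreover have "measure M {y<..z} = (LINT x:{y..z}|lborel. h x) / Z"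
  proof -
    have "AE x in lborel. indicator {y<..z} x *\<^sub>R (h x / Z) = indicator {y..z} x *\<^sub>R (h x / Z)"
      using AE_lborel_singleton[of y] by eventually_elim (simp add: indicator_def)
    then have "(LINT x:{y<..z}|lborel. h x / Z) = (LINT x:{y..z}|lborel. h x / Z)"
      unfolding set_lebesgue_integral_def by (rule integral_cong_AE[rotated 2]) measurable
    then show ?thesis by (subst meas) (auto simp: set_lebesgue_integral_def)
  qed
  ultimately show ?thesis using Z by (simp add: field_simps)
qed

text \<open>Increments alone determine \<open>h\<close> only up to null sets; continuity is what
  makes the formula hold at each \<open>y\<close>.\<close>

lemma fourier_inversion_nonneg:
  fixes h :: "real \<Rightarrow> real" and \<phi> :: "real \<Rightarrow> complex"
  assumes nonneg: "\<And>x. 0 \<le> h x" and cont: "continuous_on UNIV h" and int: "integrable lborel h"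
    and \<phi>: "\<And>t. \<phi> t = (CLINT x|lborel. complex_of_real (h x) * iexp (t * x))"
    and int\<phi>: "integrable lborel \<phi>"
  shows "complex_of_real (h y) = 1 / (2 * pi) * (CLINT t|lborel. \<phi> t * iexp (-(t * y)))"
proof -
  define \<epsilon> where "\<epsilon> n = 1 / real (Suc n)" for n
  have \<epsilon>: "0 < \<epsilon> n" "\<epsilon> n \<le> 1" for n by (auto simp: \<epsilon>_def)
  have \<epsilon>0: "\<epsilon> \<longlonglongrightarrow> 0" unfolding \<epsilon>_def by (rule LIMSEQ_Suc[OF lim_1_over_n])
  have [measurable]: "\<phi> \<in> borel_measurable borel"
    using borel_measurable_integrable[OF int\<phi>] by simp
  \<comment> \<open>Differentiate the increment formula at \<open>y\<close>: both difference quotients converge.\<close>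
  let ?L = "\<lambda>n. (LINT x:{y..y + \<epsilon> n}|lborel. h x) / \<epsilon> n"
  let ?F = "\<lambda>n t. (iexp (-(t * y)) - iexp (-(t * (y + \<epsilon> n)))) / (\<i> * t) / \<epsilon> n"
  have "?L \<longlonglongrightarrow> h y"
  proof -
    have "((\<lambda>x. integral {y..x} h) has_real_derivative h y) (at y within {y..y+1})"
      by (rule integral_has_real_derivative) (auto intro: continuous_on_subset[OF cont])
    then have "((\<lambda>x. (integral {y..x} h - integral {y..y} h) / (x - y)) \<longlongrightarrow> h y) (at y within {y..y+1})"
      by (simp add: has_field_derivative_iff)
    moreover have "filterlim (\<lambda>n. y + \<epsilon> n) (at y within {y..y+1}) sequentially"
      unfolding filterlim_at
      using \<epsilon> tendsto_add[OF tendsto_const \<epsilon>0, of y] by (auto simp: less_imp_le less_imp_neq[symmetric])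
    ultimately have "(\<lambda>n. (integral {y..y + \<epsilon> n} h - integral {y..y} h) / (y + \<epsilon> n - y)) \<longlonglongrightarrow> h y"
      by (rule filterlim_compose)
    moreover have "(LINT x:{y..y + \<epsilon> n}|lborel. h x) = integral {y..y + \<epsilon> n} h" for n
    proof (rule set_borel_integral_eq_integral(2))
      show "set_integrable lborel {y..y + \<epsilon> n} h"
        unfolding set_integrable_def by (rule integrable_mult_indicator[OF _ int]) auto
    qed
    ultimately show ?thesis by simp
  qed
  then have "(\<lambda>n. complex_of_real (?L n)) \<longlonglongrightarrow> h y" by (rule tendsto_of_real)
  moreover have "complex_of_real (?L n) = 1 / (2 * pi) * (CLINT t|lborel. ?F n t * \<phi> t)" for n
  proof -
    have "complex_of_real (?L n) = 1 / (2 * pi) *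
        ((CLINT t|lborel. (iexp (-(t * y)) - iexp (-(t * (y + \<epsilon> n)))) / (\<i> * t) * \<phi> t) / \<epsilon> n)"
      using fourier_increment_nonneg[OF nonneg int \<phi> int\<phi>, of y "y + \<epsilon> n"] \<epsilon>(1)[of n] by simp
    also have "(CLINT t|lborel. (iexp (-(t * y)) - iexp (-(t * (y + \<epsilon> n)))) / (\<i> * t) * \<phi> t) / \<epsilon> n
        = (CLINT t|lborel. (iexp (-(t * y)) - iexp (-(t * (y + \<epsilon> n)))) / (\<i> * t) * \<phi> t / \<epsilon> n)"
      by (rule integral_divide_zero[symmetric])
    finally show ?thesis by (simp add: field_simps)
  qed
  moreover have "(\<lambda>n. 1 / (2 * pi) * (CLINT t|lborel. ?F n t * \<phi> t)) \<longlonglongrightarrow>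
      1 / (2 * pi) * (CLINT t|lborel. \<phi> t * iexp (-(t * y)))"
  proof (intro tendsto_mult tendsto_const integral_dominated_convergence[where w="\<lambda>t. cmod (\<phi> t)"])
    \<comment> \<open>At \<open>t = 0\<close> the quotient is 0 for every \<open>n\<close>, not
      close to \<open>\<phi> 0\<close>, so this point has to be discarded as a null set.\<close>
    have nz: "AE t in lborel. t \<noteq> (0::real)" by (rule AE_lborel_singleton)
    show "AE t in lborel. (\<lambda>n. ?F n t * \<phi> t) \<longlonglongrightarrow> \<phi> t * iexp (-(t * y))"
      using nz
    proof eventually_elim
      case (elim t)
      have "((\<lambda>w. exp (- (\<i> * t * w))) has_field_derivative - (\<i> * t) * exp (- (\<i> * t * of_real y))) (at (of_real y))"
        by (auto intro!: derivative_eq_intros)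
      then have "((\<lambda>w. (exp (- (\<i> * t * w)) - exp (- (\<i> * t * of_real y))) / (w - of_real y)) \<longlongrightarrow> - (\<i> * t) * exp (- (\<i> * t * of_real y))) (at (complex_of_real y))"
        by (simp add: has_field_derivative_iff)
      moreover have "filterlim (\<lambda>n. complex_of_real (y + \<epsilon> n)) (at (complex_of_real y)) sequentially"
        unfolding filterlim_at
      proof
        show "(\<lambda>n. complex_of_real (y + \<epsilon> n)) \<longlonglongrightarrow> complex_of_real y"
          using tendsto_of_real[OF tendsto_add[OF tendsto_const \<epsilon>0, of y]] by simp
        show "\<forall>\<^sub>F n in sequentially. complex_of_real (y + \<epsilon> n) \<in> UNIV \<and> complex_of_real (y + \<epsilon> n) \<noteq> complex_of_real y"
          using \<epsilon>(1) by (auto simp: less_imp_neq[symmetric])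
      qed
      ultimately have "(\<lambda>n. (exp (- (\<i> * t * of_real (y + \<epsilon> n))) - exp (- (\<i> * t * of_real y))) / (of_real (y + \<epsilon> n) - of_real y))
           \<longlonglongrightarrow> - (\<i> * t) * exp (- (\<i> * t * of_real y))"
        by (rule filterlim_compose)
      then have "(\<lambda>n. (exp (- (\<i> * t * of_real (y + \<epsilon> n))) - exp (- (\<i> * t * of_real y))) / (of_real (y + \<epsilon> n) - of_real y) * (- \<phi> t / (\<i> * t)))
           \<longlonglongrightarrow> - (\<i> * t) * exp (- (\<i> * t * of_real y)) * (- \<phi> t / (\<i> * t))"
        by (intro tendsto_mult tendsto_const)
      moreover have "- (\<i> * t) * exp (- (\<i> * t * of_real y)) * (- \<phi> t / (\<i> * t)) = \<phi> t * iexp (-(t * y))"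
        using elim by (simp add: field_simps)
      moreover have "(exp (- (\<i> * t * of_real (y + \<epsilon> n))) - exp (- (\<i> * t * of_real y))) / (of_real (y + \<epsilon> n) - of_real y) * (- \<phi> t / (\<i> * t))
          = ?F n t * \<phi> t" for n
        using elim \<epsilon>(1)[of n] by (simp add: field_simps)
      ultimately show ?case by simp
    qed
    show "AE t in lborel. norm (?F n t * \<phi> t) \<le> cmod (\<phi> t)" for n
    proof (rule AE_I2)
      fix t
      \<comment> \<open>The increment over an interval of length \<open>\<epsilon> n\<close> has
        size at most \<open>\<epsilon> n\<close>; dividing by \<open>\<epsilon> n\<close> leaves 1,
        so \<open>cmod (\<phi> t)\<close> dominates uniformly in \<open>n\<close>.\<close>
      have "cmod ((iexp (-(t * y)) - iexp (-(t * (y + \<epsilon> n)))) / (\<i> * t)) \<le> \<epsilon> n"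
        using Levy_Inversion_aux2[of "-(y + \<epsilon> n)" "-y" t] \<epsilon>(1)[of n] by (cases "t = 0") (auto simp: algebra_simps)
      then have "cmod (?F n t) \<le> 1"
        using \<epsilon>(1)[of n] by (subst norm_divide) (simp add: divide_le_eq)
      then show "norm (?F n t * \<phi> t) \<le> cmod (\<phi> t)"
        unfolding norm_mult by (rule mult_left_le_one_le[rotated 2]) auto
    qed
  qed (use int\<phi> in auto)
  ultimately show ?thesis
    using LIMSEQ_unique by (metis (lifting) ext)
qed

subsection \<open>Mellin transforms of functions on a sector\<close>

lemma of_real_powr_eq:
  "0 \<le> x \<Longrightarrow> complex_of_real x powr s = (if x = 0 then 0 else exp (s * of_real (ln x)))"
  by (auto simp: powr_def Ln_of_real)

lemma norm_of_real_powr: "0 \<le> x \<Longrightarrow> cmod (complex_of_real x powr s) = x powr Re s"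
  by (auto simp: of_real_powr_eq powr_def)

text \<open>The absolute value provides the nonnegativity under which a complex power reduces to
  \<open>exp\<close> and the real logarithm, avoiding the branch cut of \<open>Ln\<close>.\<close>

lemma measurable_of_real_powr [measurable (raw)]:
  assumes [measurable]: "f \<in> borel_measurable M" "g \<in> borel_measurable M"
  shows "(\<lambda>x. complex_of_real \<bar>f x\<bar> powr g x) \<in> borel_measurable M"
  by (simp add: of_real_powr_eq) measurable

text \<open>On the half-line the complex power differs from the real power with exponent
  \<open>Re s - 1\<close> by a factor of modulus 1, so absolute convergence depends on
  \<open>Re s\<close> only.\<close>

lemma set_integrable_mellin:
  assumes "set_integrable lborel {0<..} (\<lambda>x. f x * complex_of_real (x powr (Re s - 1)))"
  shows "set_integrable lborel {0<..} (\<lambda>x. f x * complex_of_real x powr (s - 1))"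
proof -
  define k where "k = (\<lambda>x. indicator {0<..} x *\<^sub>R (f x * complex_of_real (x powr (Re s - 1))))"
  have k: "integrable lborel k" using assms by (simp add: k_def set_integrable_def)
  then have [measurable]: "k \<in> borel_measurable borel" by (auto dest: borel_measurable_integrable)
  have eq: "indicator {0<..} x *\<^sub>R (f x * complex_of_real x powr (s - 1)) = k x * exp (\<i> * of_real (Im s * ln x))" for x
  proof (cases "x > 0")
    case True
    have "(s - 1) * of_real (ln x) = of_real ((Re s - 1) * ln x) + \<i> * of_real (Im s * ln x)"
      by (simp add: complex_eq_iff)
    then have "complex_of_real x powr (s - 1) = of_real (x powr (Re s - 1)) * exp (\<i> * of_real (Im s * ln x))"
      using True by (simp only: of_real_powr_eq exp_add) (simp add: powr_def flip: exp_of_real)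
    then show ?thesis using True by (simp add: k_def)
  qed (auto simp: k_def)
  show ?thesis
    unfolding set_integrable_def eq
  proof (rule Bochner_Integration.integrable_bound[OF k])
    show "AE x in lborel. norm (k x * iexp (Im s * ln x)) \<le> norm (k x)"
      unfolding norm_mult norm_exp_i_times by simp
  qed measurable
qed

section \<open>Functions on a sector in logarithmic coordinates\<close>

lemma exp_in_sector: "\<beta> < pi \<Longrightarrow> \<bar>Im w\<bar> \<le> \<beta> \<Longrightarrow> exp w \<in> sector \<beta>"
  using Arg_exp[of w] by (simp add: sector_def)

text \<open>The growth conditions control \<open>F\<close> only near 0 and near infinity;
  compactness of a rectangle handles the rest. Multiplying by \<open>exp (\<gamma> Re w)\<close>
  with \<open>\<gamma>\<close> strictly between \<open>a\<close> and \<open>b\<close> turns the two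
  power bounds into exponential decay on both sides, at a rate given by the distance of
  \<open>\<gamma>\<close> to the nearer endpoint.\<close>

lemma sector_class_strip:
  assumes \<beta>: "0 < \<beta>" "\<beta> < pi" and f: "sector_class \<beta> a b f" and \<gamma>: "a < \<gamma>" "\<gamma> < b"
  obtains F K \<delta> where "(\<lambda>w. F (exp w)) holomorphic_on {w. \<bar>Im w\<bar> \<le> \<beta>}"
    "\<And>x. x > 0 \<Longrightarrow> F (complex_of_real x) = f x" "\<delta> > 0" "K > 0"
    "\<And>w. \<bar>Im w\<bar> \<le> \<beta> \<Longrightarrow> cmod (F (exp w)) * exp (\<gamma> * Re w) \<le> K * exp (- \<delta> * \<bar>Re w\<bar>)"
proof -
  obtain F C1 r C2 R where F: "F holomorphic_on sector \<beta>" "\<And>x. x > 0 \<Longrightarrow> F (complex_of_real x) = f x"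
    and r: "r > 0" "\<And>z. z \<in> sector \<beta> \<Longrightarrow> cmod z \<le> r \<Longrightarrow> cmod (F z) \<le> C1 * cmod z powr (- a)"
    and R: "\<And>z. z \<in> sector \<beta> \<Longrightarrow> cmod z \<ge> R \<Longrightarrow> cmod (F z) \<le> C2 * cmod z powr (- b)"
    using f unfolding sector_class_def by metis
  define S where "S = {w. \<bar>Im w\<bar> \<le> \<beta>}"
  have S: "exp w \<in> sector \<beta>" if "w \<in> S" for w
    using exp_in_sector[OF \<beta>(2)] that by (auto simp: S_def)
  have hol: "(\<lambda>w. F (exp w)) holomorphic_on S"
    using holomorphic_on_compose_gen[OF holomorphic_on_exp F(1), of S] S by (auto simp: o_def)
  \<comment> \<open>If neither asymptotic bound applies then
    \<open>\<bar>Re w\<bar> \<le> U\<close>. The maximum with 0 lets the left region be restricted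
    to \<open>Re w \<le> 0\<close>, and \<open>max R 1\<close> makes the right region lie in
    \<open>Re w \<ge> 0\<close>, so that the sign of \<open>Re w\<close> is known in both.\<close>
  define U where "U = max (max 0 (- ln r)) (ln (max R 1))"
  define \<delta> where "\<delta> = min (\<gamma> - a) (b - \<gamma>)"
  have \<delta>: "\<delta> > 0" "\<delta> \<le> \<gamma> - a" "\<delta> \<le> b - \<gamma>" using \<gamma> by (auto simp: \<delta>_def)
  have "compact (cbox (Complex (- U) (- \<beta>)) (Complex U \<beta>))" by simp
  moreover have "continuous_on (cbox (Complex (- U) (- \<beta>)) (Complex U \<beta>)) (\<lambda>w. F (exp w) * exp (\<gamma> * Re w) * exp (\<delta> * \<bar>Re w\<bar>))"
    by (intro continuous_intros continuous_on_subset[OF holomorphic_on_imp_continuous_on[OF hol]])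
       (auto simp: S_def in_cbox_complex_iff)
  ultimately have "bounded ((\<lambda>w. F (exp w) * exp (\<gamma> * Re w) * exp (\<delta> * \<bar>Re w\<bar>)) ` cbox (Complex (- U) (- \<beta>)) (Complex U \<beta>))"
    by (intro compact_imp_bounded compact_continuous_image)
  then obtain C3 where C3: "\<And>w. w \<in> cbox (Complex (- U) (- \<beta>)) (Complex U \<beta>) \<Longrightarrow>
      cmod (F (exp w) * exp (\<gamma> * Re w) * exp (\<delta> * \<bar>Re w\<bar>)) \<le> C3"
    unfolding bounded_iff by blast
  \<comment> \<open>The constants obtained from the growth conditions may be negative, hence the
    absolute values; the summand 1 gives strict positivity.\<close>
  define K where "K = \<bar>C1\<bar> + \<bar>C2\<bar> + \<bar>C3\<bar> + 1"
  have bd: "cmod (F (exp w)) * exp (\<gamma> * Re w) \<le> K * exp (- \<delta> * \<bar>Re w\<bar>)" if w: "w \<in> S" for w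
  proof -
    consider "Re w \<le> ln r" "Re w \<le> 0" | "Re w \<ge> ln (max R 1)" | "\<bar>Re w\<bar> \<le> U"
      unfolding U_def by linarith
    then show ?thesis
    proof cases
      case 1
      then have "cmod (exp w) \<le> r"
        using r(1) by (metis exp_le_cancel_iff exp_ln norm_exp_eq_Re)
      with r(2)[OF S[OF w]] have "cmod (F (exp w)) \<le> C1 * exp (- a * Re w)"
        by (simp add: powr_def)
      then have "cmod (F (exp w)) * exp (\<gamma> * Re w) \<le> C1 * exp (- a * Re w) * exp (\<gamma> * Re w)"
        by (intro mult_right_mono) auto
      also have "\<dots> = C1 * exp ((\<gamma> - a) * Re w)"
        by (simp add: algebra_simps flip: exp_add)
      also have "\<dots> \<le> K * exp ((\<gamma> - a) * Re w)"
        by (intro mult_right_mono) (auto simp: K_def)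
      also have "\<dots> \<le> K * exp (- \<delta> * \<bar>Re w\<bar>)"
      proof -
        have "(\<gamma> - a) * Re w \<le> \<delta> * Re w" using 1 \<delta> by (intro mult_right_mono_neg) auto
        with 1 show ?thesis by (intro mult_left_mono) (auto simp: K_def)
      qed
      finally show ?thesis .
    next
      case 2
      then have "cmod (exp w) \<ge> max R 1"
        by (metis exp_le_cancel_iff exp_ln less_max_iff_disj norm_exp_eq_Re zero_less_one)
      with R[OF S[OF w]] have "cmod (F (exp w)) \<le> C2 * exp (- b * Re w)"
        by (simp add: powr_def)
      then have "cmod (F (exp w)) * exp (\<gamma> * Re w) \<le> C2 * exp (- b * Re w) * exp (\<gamma> * Re w)"
        by (intro mult_right_mono) auto
      also have "\<dots> = C2 * exp (- (b - \<gamma>) * Re w)"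
        by (simp add: algebra_simps flip: exp_add)
      also have "\<dots> \<le> K * exp (- (b - \<gamma>) * Re w)"
        by (intro mult_right_mono) (auto simp: K_def)
      also have "\<dots> \<le> K * exp (- \<delta> * \<bar>Re w\<bar>)"
      proof -
        have "0 \<le> Re w" using 2 by (smt (verit) ln_ge_zero max.cobounded2)
        moreover from this have "\<delta> * Re w \<le> (b - \<gamma>) * Re w" using \<delta> by (intro mult_right_mono) auto
        ultimately show ?thesis by (intro mult_left_mono) (auto simp: K_def algebra_simps)
      qed
      finally show ?thesis .
    next
      case 3
      then have "w \<in> cbox (Complex (- U) (- \<beta>)) (Complex U \<beta>)"
        using w by (auto simp: in_cbox_complex_iff S_def)
      from C3[OF this] have "cmod (F (exp w)) * exp (\<gamma> * Re w) * exp (\<delta> * \<bar>Re w\<bar>) \<le> K"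
        by (simp add: norm_mult K_def)
      then show ?thesis by (simp add: exp_minus field_simps)
    qed
  qed
  show ?thesis
    by (rule that[of F \<delta> K]) (use hol F bd \<delta> in \<open>auto simp: S_def K_def\<close>)
qed

text \<open>On the line \<open>Im w = \<theta>\<close> the kernel \<open>exp (s w)\<close> acquires
  the factor \<open>exp (- v \<theta>)\<close>, while \<open>exp (- \<delta> \<bar>u\<bar>)\<close>
  remains to make the integral converge with a bound free of \<open>v\<close>.\<close>

lemma mellin_sector_decay:
  assumes \<beta>: "0 < \<beta>" "\<beta> < pi" and f: "sector_class \<beta> a b f" and \<gamma>: "a < \<gamma>" "\<gamma> < b"
  obtains K where "K > 0"
    "\<And>v. cmod (mellin f (Complex \<gamma> v)) \<le> K * exp (- \<beta> * \<bar>v\<bar>)"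
proof -
  obtain F K \<delta> where F: "(\<lambda>w. F (exp w)) holomorphic_on {w. \<bar>Im w\<bar> \<le> \<beta>}"
    "\<And>x. x > 0 \<Longrightarrow> F (complex_of_real x) = f x" "\<delta> > 0" "K > 0"
    and bd: "\<And>w. \<bar>Im w\<bar> \<le> \<beta> \<Longrightarrow> cmod (F (exp w)) * exp (\<gamma> * Re w) \<le> K * exp (- \<delta> * \<bar>Re w\<bar>)"
    using sector_class_strip[OF \<beta> f \<gamma>] by metis
  define I where "I = (LINT u|lborel. exp (- \<delta> * \<bar>u\<bar>))"
  have int: "integrable lborel (\<lambda>u. exp (- \<delta> * \<bar>u\<bar>))" by (rule integrable_exp_abs[OF F(3)])
  have "I \<ge> 0" unfolding I_def by (rule integral_nonneg_AE) auto
  have "cmod (mellin f (Complex \<gamma> v)) \<le> (K * (I + 1)) * exp (- \<beta> * \<bar>v\<bar>)" for v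
  proof -
    define s where "s = Complex \<gamma> v"
    define G where "G = (\<lambda>w. F (exp w) * exp (s * w))"
    have Gn: "cmod (G w) = cmod (F (exp w)) * exp (\<gamma> * Re w) * exp (- v * Im w)" for w
      by (simp add: G_def norm_mult s_def flip: exp_add)
    \<comment> \<open>The edge is chosen on the side of the sign of \<open>v\<close>, so that
      \<open>v \<theta> = \<beta> \<bar>v\<bar>\<close> in both cases.\<close>
    define \<theta> where "\<theta> = (if v \<ge> 0 then \<beta> else - \<beta>)"
    have \<theta>: "\<bar>\<theta>\<bar> \<le> \<beta>" "v * \<theta> = \<beta> * \<bar>v\<bar>" using \<beta> by (auto simp: \<theta>_def)
    have hol: "G holomorphic_on {w. \<bar>Im w\<bar> \<le> \<beta>}"
      unfolding G_def by (intro holomorphic_intros F)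
    \<comment> \<open>This constant grows with \<open>v\<close>, which is harmless: the bound only
      licenses the shift for a fixed \<open>v\<close>. The decay comes from the sharper evaluation
      on the edge itself.\<close>
    have Gbd: "cmod (G w) \<le> K * exp (\<bar>v\<bar> * \<beta>) * exp (- \<delta> * \<bar>Re w\<bar>)" if "\<bar>Im w\<bar> \<le> \<beta>" for w
    proof -
      have "- v * Im w \<le> \<bar>v * Im w\<bar>" by simp
      also have "\<dots> \<le> \<bar>v\<bar> * \<beta>"
        unfolding abs_mult using that by (intro mult_left_mono) auto
      finally have "exp (- v * Im w) \<le> exp (\<bar>v\<bar> * \<beta>)" by simp
      then have "cmod (G w) \<le> (K * exp (- \<delta> * \<bar>Re w\<bar>)) * exp (\<bar>v\<bar> * \<beta>)"
        unfolding Gn by (rule mult_mono[OF bd[OF that]]) (use F(4) in auto)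
      then show ?thesis by (simp add: mult_ac)
    qed
    have shift: "integrable lborel (\<lambda>u. G (Complex u \<theta>))"
      "(LINT u|lborel. G (Complex u \<theta>)) = (LINT u|lborel. G (of_real u))"
      using strip_contour_shift[OF hol F(3) _ \<theta>(1)] Gbd by blast+
    have si: "set_integrable lborel {0<..} (\<lambda>x. f x * complex_of_real x powr (s - 1))"
      using f \<gamma> by (intro set_integrable_mellin) (auto simp: sector_class_def mellin_class_def s_def)
    have "mellin f s = (LINT u|lborel. exp u *\<^sub>R (f (exp u) * complex_of_real (exp u) powr (s - 1)))"
      unfolding mellin_def by (rule integral_exp_substitution(2)[OF si, symmetric])
    also have "\<dots> = (LINT u|lborel. G (of_real u))"
    proof (rule Bochner_Integration.integral_cong[OF refl])
      fix u :: real
      have "complex_of_real (exp u) * exp ((s - 1) * of_real u) = exp (s * of_real u)"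
        by (simp add: algebra_simps exp_diff flip: exp_of_real)
      then show "exp u *\<^sub>R (f (exp u) * complex_of_real (exp u) powr (s - 1)) = G (of_real u)"
        using F(2)[of "exp u"] by (simp add: G_def of_real_powr_eq scaleR_conv_of_real mult_ac exp_of_real)
    qed
    also have "\<dots> = (LINT u|lborel. G (Complex u \<theta>))" using shift(2) by simp
    also have "cmod \<dots> \<le> (LINT u|lborel. (K * exp (- \<beta> * \<bar>v\<bar>)) * exp (- \<delta> * \<bar>u\<bar>))"
    proof (rule Bochner_Integration.integral_norm_bound_integral[OF shift(1)])
      show "integrable lborel (\<lambda>u. (K * exp (- \<beta> * \<bar>v\<bar>)) * exp (- \<delta> * \<bar>u\<bar>))" using int by simp
      fix u :: real
      show "norm (G (Complex u \<theta>)) \<le> (K * exp (- \<beta> * \<bar>v\<bar>)) * exp (- \<delta> * \<bar>u\<bar>)"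
        unfolding Gn using mult_right_mono[OF bd[of "Complex u \<theta>"], of "exp (- \<beta> * \<bar>v\<bar>)"] \<theta>
        by (simp add: mult_ac)
    qed
    also have "\<dots> = K * exp (- \<beta> * \<bar>v\<bar>) * I" by (simp add: I_def)
    also have "\<dots> \<le> (K * (I + 1)) * exp (- \<beta> * \<bar>v\<bar>)" using F(4) by (simp add: algebra_simps)
    finally show ?thesis by (simp add: s_def)
  qed
  then show ?thesis using that[of "K * (I + 1)"] F(4) \<open>I \<ge> 0\<close> by simp
qed

section \<open>Vertical lines: the Mellin transform as a Fourier transform\<close>

lemma isCont_fourier:
  fixes k :: "real \<Rightarrow> complex"
  assumes k: "integrable lborel k"
  shows "isCont (\<lambda>t. CLINT u|lborel. k u * iexp (t * u)) t"
  unfolding continuous_at_sequentially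
proof safe
  fix X assume X: "X \<longlonglongrightarrow> t"
  note [measurable] = borel_measurable_integrable[OF k]
  show "((\<lambda>t. CLINT u|lborel. k u * iexp (t * u)) \<circ> X) \<longlonglongrightarrow> (CLINT u|lborel. k u * iexp (t * u))"
    unfolding comp_def
  proof (rule integral_dominated_convergence[where w="\<lambda>u. cmod (k u)"])
    show "AE u in lborel. (\<lambda>n. k u * iexp (X n * u)) \<longlonglongrightarrow> k u * iexp (t * u)"
      by (intro AE_I2 tendsto_intros X)
    show "AE u in lborel. norm (k u * iexp (X n * u)) \<le> cmod (k u)" for n
      unfolding norm_mult norm_exp_i_times by simp
  qed (use k in \<open>auto intro: integrable_norm\<close>)
qed

lemma mellin_eq_fourier:
  assumes "set_integrable lborel {0<..} (\<lambda>x. f x * complex_of_real (x powr (c - 1)))"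
  shows "integrable lborel (\<lambda>u. f (exp u) * complex_of_real (exp (c * u)))"
    and "mellin f (Complex c v) = (CLINT u|lborel. f (exp u) * complex_of_real (exp (c * u)) * iexp (v * u))"
proof -
  have si: "set_integrable lborel {0<..} (\<lambda>x. f x * complex_of_real x powr (Complex c v - 1))" for v
    by (rule set_integrable_mellin) (use assms in simp)
  have eq: "exp u *\<^sub>R (f (exp u) * complex_of_real (exp u) powr (Complex c v - 1))
      = f (exp u) * complex_of_real (exp (c * u)) * iexp (v * u)" for u v
  proof -
    have "of_real u + (Complex c v - 1) * of_real u = of_real (c * u) + \<i> * of_real (v * u)"
      by (simp add: complex_eq_iff algebra_simps)
    moreover have "complex_of_real (exp u) powr (Complex c v - 1) = exp ((Complex c v - 1) * of_real u)"
      by (subst of_real_powr_eq) auto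
    ultimately have "complex_of_real (exp u) * complex_of_real (exp u) powr (Complex c v - 1) = of_real (exp (c * u)) * iexp (v * u)"
      by (simp only: flip: exp_of_real exp_add)
    then show ?thesis by (simp add: scaleR_conv_of_real mult_ac)
  qed
  show "integrable lborel (\<lambda>u. f (exp u) * complex_of_real (exp (c * u)))"
    using integral_exp_substitution(1)[OF si[of 0]] unfolding eq by simp
  show "mellin f (Complex c v) = (CLINT u|lborel. f (exp u) * complex_of_real (exp (c * u)) * iexp (v * u))"
    using integral_exp_substitution(2)[OF si[of v]] unfolding eq mellin_def by simp
qed

lemma isCont_mellin_vertical:
  assumes "set_integrable lborel {0<..} (\<lambda>x. f x * complex_of_real (x powr (c - 1)))"
  shows "isCont (\<lambda>v. mellin f (Complex c v)) v"
  unfolding mellin_eq_fourier(2)[OF assms]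
  by (rule isCont_fourier[OF mellin_eq_fourier(1)[OF assms]])

lemma integrable_mellin_sector:
  assumes \<beta>: "0 < \<beta>" "\<beta> < pi" and f: "sector_class \<beta> a b f" and \<gamma>: "a < \<gamma>" "\<gamma> < b"
  shows "integrable lborel (\<lambda>v. mellin f (Complex \<gamma> v))"
proof -
  have si: "set_integrable lborel {0<..} (\<lambda>x. f x * complex_of_real (x powr (\<gamma> - 1)))"
    using f \<gamma> by (auto simp: sector_class_def mellin_class_def)
  obtain K where K: "K > 0" "\<And>v. cmod (mellin f (Complex \<gamma> v)) \<le> K * exp (- \<beta> * \<bar>v\<bar>)"
    using mellin_sector_decay[OF \<beta> f \<gamma>] by metis
  show ?thesis
  proof (rule Bochner_Integration.integrable_bound)
    show "integrable lborel (\<lambda>v. K * exp (- \<beta> * \<bar>v\<bar>))"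
      using integrable_exp_abs[OF \<beta>(1)] by simp
    show "(\<lambda>v. mellin f (Complex \<gamma> v)) \<in> borel_measurable lborel"
      using isCont_mellin_vertical[OF si]
      by (simp add: borel_measurable_continuous_onI continuous_at_imp_continuous_on)
    show "AE v in lborel. norm (mellin f (Complex \<gamma> v)) \<le> norm (K * exp (- \<beta> * \<bar>v\<bar>))"
      using K by (intro AE_I2) (simp add: abs_mult)
  qed
qed

text \<open>This is Fourier inversion for \<open>h\<close> at the point \<open>ln x\<close>, divided
  by \<open>x powr \<gamma>\<close>. The continuity of \<open>h\<close> that pointwise inversion
  demands is inherited from the holomorphic extension of \<open>f\<close>.\<close>

lemma mellin_inversion_sector:
  fixes f :: "real \<Rightarrow> real"
  assumes \<beta>: "0 < \<beta>" "\<beta> < pi" and f: "sector_class \<beta> a b (\<lambda>x. complex_of_real (f x))"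
    and \<gamma>: "a < \<gamma>" "\<gamma> < b" and nonneg: "\<And>x. 0 \<le> f x" and x: "x > 0"
  shows "complex_of_real (f x) = 1 / (2 * pi) *
    (CLINT v|lborel. mellin (\<lambda>x. complex_of_real (f x)) (Complex \<gamma> v) * complex_of_real x powr (- Complex \<gamma> v))"
proof -
  let ?f = "\<lambda>x. complex_of_real (f x)"
  define h where "h u = f (exp u) * exp (\<gamma> * u)" for u
  have si: "set_integrable lborel {0<..} (\<lambda>x. ?f x * complex_of_real (x powr (\<gamma> - 1)))"
    using f \<gamma> by (auto simp: sector_class_def mellin_class_def)
  have h: "complex_of_real (h u) = ?f (exp u) * complex_of_real (exp (\<gamma> * u))" for u
    by (simp add: h_def)
  have int: "integrable lborel h"
    using mellin_eq_fourier(1)[OF si] unfolding h[symmetric] by (simp only: complex_of_real_integrable_eq)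
  have \<phi>: "mellin ?f (Complex \<gamma> v) = (CLINT u|lborel. complex_of_real (h u) * iexp (v * u))" for v
    unfolding h by (rule mellin_eq_fourier(2)[OF si])
  obtain F where F: "(\<lambda>w. F (exp w)) holomorphic_on {w. \<bar>Im w\<bar> \<le> \<beta>}"
    "\<And>x. x > 0 \<Longrightarrow> F (complex_of_real x) = ?f x"
    using sector_class_strip[OF \<beta> f \<gamma>] by metis
  have "continuous_on UNIV (\<lambda>u. F (exp (complex_of_real u)))"
    by (rule continuous_on_compose2[OF holomorphic_on_imp_continuous_on[OF F(1)]])
       (use \<beta> in \<open>auto intro!: continuous_intros\<close>)
  then have "continuous_on UNIV (\<lambda>u. Re (F (exp (complex_of_real u))))"
    by (rule continuous_on_Re)
  moreover have "Re (F (exp (complex_of_real u))) = f (exp u)" for u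
    using F(2)[of "exp u"] by (simp add: exp_of_real)
  ultimately have "continuous_on UNIV h"
    unfolding h_def by (auto intro!: continuous_intros)
  from fourier_inversion_nonneg[OF _ this int \<phi> integrable_mellin_sector[OF \<beta> f \<gamma>], of "ln x"]
  have "complex_of_real (h (ln x)) = 1 / (2 * pi) * (CLINT v|lborel. mellin ?f (Complex \<gamma> v) * iexp (- (v * ln x)))"
    using nonneg by (simp add: h_def)
  moreover have "h (ln x) = f x * x powr \<gamma>" using x by (simp add: h_def powr_def)
  ultimately have "complex_of_real (f x) = complex_of_real (x powr - \<gamma>) * (1 / (2 * pi) *
      (CLINT v|lborel. mellin ?f (Complex \<gamma> v) * iexp (- (v * ln x))))"
    using x by (simp add: powr_minus field_simps)
  also have "\<dots> = 1 / (2 * pi) *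
      (CLINT v|lborel. complex_of_real (x powr - \<gamma>) * (mellin ?f (Complex \<gamma> v) * iexp (- (v * ln x))))"
    by simp
  also have "(\<lambda>v. complex_of_real (x powr - \<gamma>) * (mellin ?f (Complex \<gamma> v) * iexp (- (v * ln x))))
      = (\<lambda>v. mellin ?f (Complex \<gamma> v) * complex_of_real x powr (- Complex \<gamma> v))"
  proof
    fix v
    have "- Complex \<gamma> v * of_real (ln x) = of_real (- \<gamma> * ln x) + \<i> * of_real (- (v * ln x))"
      by (simp add: complex_eq_iff)
    then have "complex_of_real x powr (- Complex \<gamma> v) = of_real (x powr - \<gamma>) * iexp (- (v * ln x))"
      using x by (simp only: of_real_powr_eq exp_add) (simp add: powr_def flip: exp_of_real)
    then show "complex_of_real (x powr - \<gamma>) * (mellin ?f (Complex \<gamma> v) * iexp (- (v * ln x)))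
      = mellin ?f (Complex \<gamma> v) * complex_of_real x powr (- Complex \<gamma> v)"
      by (simp add: mult_ac)
  qed
  finally show ?thesis .
qed

text \<open>The constant is \<open>K / (pi \<beta>)\<close>: the two exponential tails contribute
  \<open>2 K / \<beta>\<close>, and inversion contributes \<open>1 / (2 pi)\<close>. It is fixed
  before \<open>x\<close> and \<open>g\<close>, which gives the uniformity claimed in the
  end.\<close>

lemma mellin_inversion_tail:
  fixes f :: "real \<Rightarrow> real"
  assumes \<beta>: "0 < \<beta>" "\<beta> < pi" and f: "sector_class \<beta> a b (\<lambda>x. complex_of_real (f x))"
    and \<gamma>: "a < \<gamma>" "\<gamma> < b" and nonneg: "\<And>x. 0 \<le> f x"
  obtains C where "C > 0"
    "\<And>x g. x > 0 \<Longrightarrow> cmod (complex_of_real (f x) - 1 / (2 * pi) *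
        (CLBINT v:{-g..g}. mellin (\<lambda>x. complex_of_real (f x)) (Complex \<gamma> v) * complex_of_real x powr (- Complex \<gamma> v)))
      \<le> C * x powr (- \<gamma>) * exp (- \<beta> * g)"
proof -
  let ?m = "\<lambda>v. mellin (\<lambda>x. complex_of_real (f x)) (Complex \<gamma> v)"
  obtain K where K: "K > 0" "\<And>v. cmod (?m v) \<le> K * exp (- \<beta> * \<bar>v\<bar>)"
    using mellin_sector_decay[OF \<beta> f \<gamma>] by metis
  note int = integrable_mellin_sector[OF \<beta> f \<gamma>]
  note [measurable] = borel_measurable_integrable[OF int]
  have "cmod (complex_of_real (f x) - 1 / (2 * pi) * (CLBINT v:{-g..g}. ?m v * complex_of_real x powr (- Complex \<gamma> v)))
      \<le> (K / (pi * \<beta>)) * x powr (- \<gamma>) * exp (- \<beta> * g)" if x: "x > 0" for x g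
  proof -
    let ?I = "\<lambda>v. ?m v * complex_of_real x powr (- Complex \<gamma> v)"
    let ?S = "{v::real. g < \<bar>v\<bar>}"
    have nI: "cmod (?I v) = cmod (?m v) * x powr - \<gamma>" for v
      using x by (simp add: norm_mult norm_of_real_powr)
    have [measurable]: "(\<lambda>v. complex_of_real x powr (- Complex \<gamma> v)) \<in> borel_measurable lborel"
      using x by (simp add: of_real_powr_eq Complex_eq)
    have [measurable]: "?I \<in> borel_measurable lborel" by measurable
    have intI: "integrable lborel ?I"
      by (rule Bochner_Integration.integrable_bound[OF integrable_mult_left[OF integrable_norm[OF int], of "x powr - \<gamma>"]])
         (auto simp: nI)
    have S: "?S \<in> sets lborel" by measurable
    have si: "set_integrable lborel {-g..g} ?I" "set_integrable lborel ?S ?I"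
      unfolding set_integrable_def by (intro integrable_mult_indicator intI S; simp)+
    have "integral\<^sup>L lborel ?I = (CLBINT v:{-g..g} \<union> ?S. ?I v)"
      unfolding set_lebesgue_integral_def by (intro Bochner_Integration.integral_cong) (auto simp: indicator_def)
    also have "\<dots> = (CLBINT v:{-g..g}. ?I v) + (CLBINT v:?S. ?I v)"
      by (rule set_integral_Un[OF _ si]) auto
    finally have "complex_of_real (f x) - 1 / (2 * pi) * (CLBINT v:{-g..g}. ?I v) = 1 / (2 * pi) * (CLBINT v:?S. ?I v)"
      using mellin_inversion_sector[OF \<beta> f \<gamma> nonneg x] by (simp add: algebra_simps add_divide_distrib)
    then have "cmod (complex_of_real (f x) - 1 / (2 * pi) * (CLBINT v:{-g..g}. ?I v)) = 1 / (2 * pi) * cmod (CLBINT v:?S. ?I v)"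
      by (simp add: norm_mult norm_divide)
    also have "cmod (CLBINT v:?S. ?I v) \<le> (LINT v|lborel. (K * x powr - \<gamma>) * (indicator ?S v *\<^sub>R exp (- \<beta> * \<bar>v\<bar>)))"
      unfolding set_lebesgue_integral_def
    proof (rule Bochner_Integration.integral_norm_bound_integral)
      show "integrable lborel (\<lambda>v. indicator ?S v *\<^sub>R ?I v)"
        using si(2) by (simp add: set_integrable_def)
      show "integrable lborel (\<lambda>v. (K * x powr - \<gamma>) * (indicator ?S v *\<^sub>R exp (- \<beta> * \<bar>v\<bar>)))"
        using integrable_exp_abs_tail(1)[OF \<beta>(1), of g] unfolding set_integrable_def
        by (intro integrable_mult_right)
      fix v :: real
      have "cmod (?I v) \<le> (K * exp (- \<beta> * \<bar>v\<bar>)) * x powr - \<gamma>"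
        unfolding nI by (intro mult_right_mono K) simp
      then show "norm (indicator ?S v *\<^sub>R ?I v) \<le> (K * x powr - \<gamma>) * (indicator ?S v *\<^sub>R exp (- \<beta> * \<bar>v\<bar>))"
        by (cases "v \<in> ?S") (simp_all add: mult_ac)
    qed
    also have "\<dots> = (K * x powr - \<gamma>) * (LINT v:?S|lborel. exp (- \<beta> * \<bar>v\<bar>))"
      unfolding set_lebesgue_integral_def by (rule integral_mult_right_zero)
    also have "\<dots> \<le> (K * x powr - \<gamma>) * (2 * exp (- \<beta> * g) / \<beta>)"
      using K(1) by (intro mult_left_mono integrable_exp_abs_tail(2)[OF \<beta>(1)]) auto
    also have "1 / (2 * pi) * \<dots> = (K / (pi * \<beta>)) * x powr (- \<gamma>) * exp (- \<beta> * g)"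
      by simp
    finally show ?thesis by (simp add: divide_right_mono)
  qed
  then show ?thesis using that[of "K / (pi * \<beta>)"] K(1) \<beta>(1) by simp
qed

subsection \<open>A self-similar process at an independent time\<close>

lemma (in prob_space) indep_set_process_imp_indep_var:
  fixes T :: "'a \<Rightarrow> real" and Y :: "real \<Rightarrow> 'a \<Rightarrow> real"
  assumes "indep_set
      (sigma_sets (space M) {T -` A \<inter> space M | A. A \<in> sets borel})
      (sigma_sets (space M) (\<Union>t\<in>{0..}. {Y t -` A \<inter> space M | A. A \<in> sets borel}))"
    and "T \<in> borel_measurable M" "Y t \<in> borel_measurable M" "t \<ge> 0"
  shows "indep_var borel T borel (Y t)"
proof -
  have "sigma_sets (space M) {Y t -` A \<inter> space M | A. A \<in> sets borel}
      \<subseteq> sigma_sets (space M) (\<Union>t\<in>{0..}. {Y t -` A \<inter> space M | A. A \<in> sets borel})"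
    by (rule sigma_sets_mono') (use assms(4) in auto)
  then have "indep_set
      (sigma_sets (space M) {T -` A \<inter> space M | A. A \<in> sets borel})
      (sigma_sets (space M) {Y t -` A \<inter> space M | A. A \<in> sets borel})"
    using assms(1) unfolding indep_set_def
    by (elim indep_sets_mono) (auto split: bool.splits)
  then show ?thesis
    unfolding indep_var_eq using assms by auto
qed

lemma self_similar_marginal:
  assumes ss: "self_similar M Y H" and Y: "\<And>t. t \<ge> 0 \<Longrightarrow> Y t \<in> borel_measurable M" and t: "t > 0"
  shows "distr M borel (Y t) = distr M borel (\<lambda>\<omega>. t powr H * Y 1 \<omega>)"
proof -
  have [measurable]: "Y t \<in> borel_measurable M" "Y 1 \<in> borel_measurable M"
    using Y t by auto
  let ?P = "PiM {1::real} (\<lambda>_. borel :: real measure)"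
  \<comment> \<open>The finite-dimensional identity is used with scaling factor \<open>c = t\<close>
    and the single time point 1.\<close>
  have eq: "distr M ?P (\<lambda>\<omega>. \<lambda>s\<in>{1}. Y (t * s) \<omega>) = distr M ?P (\<lambda>\<omega>. \<lambda>s\<in>{1}. t powr H * Y s \<omega>)"
    using ss t unfolding self_similar_def by (metis atLeast_iff empty_subsetI finite.emptyI finite.insertI insert_subset zero_le_one)
  have m1: "(\<lambda>\<omega>. \<lambda>s\<in>{1::real}. Y (t * s) \<omega>) \<in> measurable M ?P"
    by (intro measurable_restrict) auto
  have m2: "(\<lambda>\<omega>. \<lambda>s\<in>{1::real}. t powr H * Y s \<omega>) \<in> measurable M ?P"
    by (intro measurable_restrict) auto
  have c: "(\<lambda>x. x 1) \<in> measurable ?P borel"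
    by (rule measurable_component_singleton) auto
  have "distr M borel (Y t) = distr (distr M ?P (\<lambda>\<omega>. \<lambda>s\<in>{1}. Y (t * s) \<omega>)) borel (\<lambda>x. x 1)"
    by (subst distr_distr[OF c m1]) (simp add: o_def)
  also have "\<dots> = distr M borel (\<lambda>\<omega>. t powr H * Y 1 \<omega>)"
    unfolding eq by (subst distr_distr[OF c m2]) (simp add: o_def)
  finally show ?thesis .
qed

text \<open>The grid point is strictly larger than \<open>t\<close>, so that right-continuity of the paths applies
  and the marginal scaling is needed at positive times only.\<close>

definition grid_above :: "nat \<Rightarrow> real \<Rightarrow> real" where
  "grid_above m t = (real (nat \<lfloor>real (Suc m) * t\<rfloor>) + 1) / real (Suc m)"

lemma grid_above_bounds:
  assumes "t \<ge> 0"
  shows "t < grid_above m t" "grid_above m t \<le> t + 1 / real (Suc m)"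
proof -
  have "real (nat \<lfloor>real (Suc m) * t\<rfloor>) = of_int \<lfloor>real (Suc m) * t\<rfloor>"
    using assms by simp
  moreover have "real (Suc m) * t < of_int \<lfloor>real (Suc m) * t\<rfloor> + 1" "of_int \<lfloor>real (Suc m) * t\<rfloor> \<le> real (Suc m) * t"
    by linarith+
  ultimately show "t < grid_above m t" "grid_above m t \<le> t + 1 / real (Suc m)"
    unfolding grid_above_def by (simp_all add: field_simps del: of_nat_Suc)
qed

lemma grid_above_tendsto:
  assumes "t \<ge> 0"
  shows "(\<lambda>m. grid_above m t) \<longlonglongrightarrow> t"
    and "filterlim (\<lambda>m. grid_above m t) (at_right t) sequentially"
proof -
  show lim: "(\<lambda>m. grid_above m t) \<longlonglongrightarrow> t"
  proof (rule tendsto_sandwich[where f = "\<lambda>_. t" and h = "\<lambda>m. t + 1 / real (Suc m)"])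
    show "(\<lambda>m. t + 1 / real (Suc m)) \<longlonglongrightarrow> t"
      using tendsto_add[OF tendsto_const LIMSEQ_Suc[OF lim_1_over_n], of t] by simp
    show "\<forall>\<^sub>F m in sequentially. t \<le> grid_above m t"
      using grid_above_bounds(1)[OF assms] by (intro always_eventually allI less_imp_le)
    show "\<forall>\<^sub>F m in sequentially. grid_above m t \<le> t + 1 / real (Suc m)"
      using grid_above_bounds(2)[OF assms] by (intro always_eventually allI)
  qed simp
  show "filterlim (\<lambda>m. grid_above m t) (at_right t) sequentially"
    using grid_above_bounds(1)[OF assms]
    by (auto simp: filterlim_at lim less_imp_neq[symmetric])
qed

text \<open>This replaces joint measurability of the process: along a countably valued time, only
  measurability at each fixed time is required.\<close>

lemma measurable_eval_at_nat:
  fixes N :: "'a \<Rightarrow> nat" and Z :: "nat \<Rightarrow> 'a \<Rightarrow> 'b :: {second_countable_topology, real_normed_vector}"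
  assumes [measurable]: "N \<in> measurable M (count_space UNIV)" "\<And>j. Z j \<in> borel_measurable M"
  shows "(\<lambda>\<omega>. Z (N \<omega>) \<omega>) \<in> borel_measurable M"
  by measurable

section \<open>The law of the process at the random time\<close>

locale stopped_self_similar = prob_space M for M :: "'a measure" +
  fixes Y :: "real \<Rightarrow> 'a \<Rightarrow> real" and H :: real and T :: "'a \<Rightarrow> real"
  assumes H: "H > 0"
    and Y_rv: "\<And>t. t \<ge> 0 \<Longrightarrow> Y t \<in> borel_measurable M"
    and Y_cadlag: "\<And>\<omega>. \<omega> \<in> space M \<Longrightarrow> cadlag (\<lambda>t. Y t \<omega>)"
    and Y_ss: "self_similar M Y H"
    and T_rv [measurable]: "T \<in> borel_measurable M"
    and T_nonneg: "\<And>\<omega>. \<omega> \<in> space M \<Longrightarrow> T \<omega> \<ge> 0"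
    and T_indep: "indep_set
                 (sigma_sets (space M) {T -` A \<inter> space M | A. A \<in> sets borel})
                 (sigma_sets (space M) (\<Union>t\<in>{0..}. {Y t -` A \<inter> space M | A. A \<in> sets borel}))"
begin

lemma grid_measurable: "(\<lambda>\<omega>. Y (grid_above m (T \<omega>)) \<omega>) \<in> borel_measurable M"
  unfolding grid_above_def
  by (rule measurable_eval_at_nat[where Z = "\<lambda>j. Y ((real j + 1) / real (Suc m))"])
     (measurable, auto intro!: Y_rv)

lemma grid_tendsto:
  assumes "\<omega> \<in> space M"
  shows "(\<lambda>m. Y (grid_above m (T \<omega>)) \<omega>) \<longlonglongrightarrow> Y (T \<omega>) \<omega>"
proof -
  have "((\<lambda>t. Y t \<omega>) \<longlongrightarrow> Y (T \<omega>) \<omega>) (at_right (T \<omega>))"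
    using Y_cadlag[OF assms] T_nonneg[OF assms] by (simp add: cadlag_def continuous_within)
  then show ?thesis
    by (rule filterlim_compose[OF _ grid_above_tendsto(2)[OF T_nonneg[OF assms]]])
qed

lemma stopped_measurable [measurable]: "(\<lambda>\<omega>. Y (T \<omega>) \<omega>) \<in> borel_measurable M"
  by (rule borel_measurable_LIMSEQ_real[OF grid_tendsto grid_measurable])

abbreviation "law1 \<equiv> distr M borel (Y 1)"

lemma Y1_rv [measurable]: "Y 1 \<in> borel_measurable M" by (rule Y_rv) simp

sublocale law1: real_distribution law1 by (rule real_distribution_distr) simp

lemma char_grid_point:
  assumes "t > 0"
  shows "(CLINT \<omega>|M. iexp (u * Y t \<omega>)) = char law1 (u * t powr H)"
proof -
  have [measurable]: "Y t \<in> borel_measurable M" using Y_rv assms by simp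
  have "(CLINT \<omega>|M. iexp (u * Y t \<omega>)) = char (distr M borel (Y t)) u"
    by (simp add: char_def integral_distr)
  also have "\<dots> = char law1 (u * t powr H)"
    by (subst self_similar_marginal[OF Y_ss Y_rv assms]) (simp_all add: char_def integral_distr mult_ac)
  finally show ?thesis .
qed

text \<open>This is conditioning on the value of a countably valued time, written without
  conditional expectations. On \<open>N = j\<close> the integrand is \<open>E j\<close>, which has
  mean 0 by scaling and is independent of that event, so every piece of the partition contributes
  0.\<close>

lemma char_grid:
  "(CLINT \<omega>|M. iexp (u * Y (grid_above m (T \<omega>)) \<omega>)) = (CLINT \<omega>|M. char law1 (u * grid_above m (T \<omega>) powr H))"
proof -
  let ?t = "\<lambda>j. (real j + 1) / real (Suc m)"
  define N where "N \<omega> = nat \<lfloor>real (Suc m) * T \<omega>\<rfloor>" for \<omega>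
  have [measurable]: "N \<in> measurable M (count_space UNIV)" unfolding N_def by measurable
  have tN: "grid_above m (T \<omega>) = ?t (N \<omega>)" for \<omega> by (simp add: grid_above_def N_def)
  define E where "E j \<omega> = iexp (u * Y (?t j) \<omega>) - char law1 (u * ?t j powr H)" for j \<omega>
  have Yt [measurable]: "Y (?t j) \<in> borel_measurable M" for j by (rule Y_rv) simp
  have E_rv [measurable]: "E j \<in> borel_measurable M" for j unfolding E_def by measurable
  have E_bd: "cmod (E j \<omega>) \<le> 2" for j \<omega>
    unfolding E_def using norm_triangle_ineq4[of "iexp (u * Y (?t j) \<omega>)" "char law1 (u * ?t j powr H)"]
      law1.cmod_char_le_1[of "u * ?t j powr H"] norm_exp_i_times[of "u * Y (?t j) \<omega>"] by linarith
  have E_int: "integrable M (E j)" for j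
    by (rule integrable_const_bound[where B=2]) (use E_bd in auto)
  have i1: "integrable M (\<lambda>\<omega>. iexp (u * Y (?t j) \<omega>))" for j
    by (rule integrable_const_bound[where B=1]) (simp, measurable)
  have E0: "integral\<^sup>L M (E j) = 0" for j
    unfolding E_def using i1[of j] char_grid_point[of "?t j" u] by (simp add: prob_space)
  define D where "D \<omega> = E (N \<omega>) \<omega>" for \<omega>
  have D_rv [measurable]: "D \<in> borel_measurable M"
    unfolding D_def by (rule measurable_eval_at_nat) measurable
  have ind: "(CLINT \<omega>|M. (if N \<omega> = j then E j \<omega> else 0)) = 0" for j
  proof -
    \<comment> \<open>Both factors are written as functions of \<open>T\<close> and of
      \<open>Y\<close> at a fixed time, so that independence of these two variables passes to
      them.\<close>
    define I where "I = (\<lambda>t. if nat \<lfloor>real (Suc m) * t\<rfloor> = j then 1 else 0 :: complex)"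
    define k where "k = (\<lambda>y. iexp (u * y) - char law1 (u * ?t j powr H))"
    have [measurable]: "I \<in> borel_measurable borel" "k \<in> borel_measurable borel"
      unfolding I_def k_def by measurable
    have "indep_var borel T borel (Y (?t j))"
      by (rule indep_set_process_imp_indep_var[OF T_indep T_rv Yt]) simp
    then have "indep_var borel (I \<circ> T) borel (k \<circ> Y (?t j))"
      by (rule indep_var_compose) measurable
    moreover have "k \<circ> Y (?t j) = E j" by (auto simp: k_def E_def)
    ultimately have iv: "indep_var borel (I \<circ> T) borel (E j)" by simp
    have "integrable M (I \<circ> T)"
      by (rule integrable_const_bound[where B=1]) (auto simp: I_def o_def)
    then have "(CLINT \<omega>|M. (I \<circ> T) \<omega> * E j \<omega>) = (CLINT \<omega>|M. (I \<circ> T) \<omega>) * integral\<^sup>L M (E j)"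
      by (rule indep_var_lebesgue_integral[OF iv _ E_int])
    moreover have "(I \<circ> T) \<omega> * E j \<omega> = (if N \<omega> = j then E j \<omega> else 0)" for \<omega>
      by (simp add: I_def N_def)
    ultimately show ?thesis by (simp add: E0)
  qed
  have part: "(CLINT \<omega>|M. (if N \<omega> < J then D \<omega> else 0)) = 0" for J
  proof -
    have "(if N \<omega> < J then D \<omega> else 0) = (\<Sum>j<J. (if N \<omega> = j then E j \<omega> else 0))" for \<omega>
      by (auto simp: D_def sum.delta')
    then have "(CLINT \<omega>|M. (if N \<omega> < J then D \<omega> else 0)) = (\<Sum>j<J. (CLINT \<omega>|M. (if N \<omega> = j then E j \<omega> else 0)))"
      by (simp only:, intro Bochner_Integration.integral_sum integrable_const_bound[where B=2])
         (use E_bd in auto)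
    then show ?thesis by (simp add: ind)
  qed
  \<comment> \<open>Finitely many values of \<open>N\<close> have been treated; the uniform bound 2
    on \<open>E\<close> allows the passage to all of them.\<close>
  have "(\<lambda>J. (CLINT \<omega>|M. (if N \<omega> < J then D \<omega> else 0))) \<longlonglongrightarrow> integral\<^sup>L M D"
  proof (rule integral_dominated_convergence[where w="\<lambda>_. 2"])
    show "AE \<omega> in M. (\<lambda>J. if N \<omega> < J then D \<omega> else 0) \<longlonglongrightarrow> D \<omega>"
    proof (intro AE_I2 tendsto_eventually)
      fix \<omega>
      show "\<forall>\<^sub>F J in sequentially. (if N \<omega> < J then D \<omega> else 0) = D \<omega>"
        by (intro eventually_sequentiallyI[of "Suc (N \<omega>)"]) auto
    qed
  qed (use E_bd in \<open>auto simp: D_def\<close>)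
  then have "integral\<^sup>L M D = 0"
    unfolding part by (simp add: LIMSEQ_const_iff)
  moreover have "integral\<^sup>L M D = (CLINT \<omega>|M. iexp (u * Y (grid_above m (T \<omega>)) \<omega>)) - (CLINT \<omega>|M. char law1 (u * grid_above m (T \<omega>) powr H))"
  proof -
    have [measurable]: "(\<lambda>\<omega>. Y (grid_above m (T \<omega>)) \<omega>) \<in> borel_measurable M"
      by (rule grid_measurable)
    have D_eq: "D = (\<lambda>\<omega>. iexp (u * Y (grid_above m (T \<omega>)) \<omega>) - char law1 (u * grid_above m (T \<omega>) powr H))"
      by (rule ext) (simp add: D_def E_def tN)
     have "integrable M (\<lambda>\<omega>. iexp (u * Y (grid_above m (T \<omega>)) \<omega>))"
      by (rule integrable_const_bound[where B=1]) auto
    moreover have "integrable M (\<lambda>\<omega>. char law1 (u * grid_above m (T \<omega>) powr H))"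
      by (rule integrable_const_bound[where B=1]) (auto simp: law1.cmod_char_le_1 grid_above_def)
    ultimately show ?thesis unfolding D_eq by (rule Bochner_Integration.integral_diff)
  qed
  ultimately show ?thesis by simp
qed

text \<open>Both sides of \<open>char_grid\<close> converge: the left one by right-continuity of the
  paths, the right one by continuity of a characteristic function.\<close>

lemma char_stopped:
  "char (distr M borel (\<lambda>\<omega>. Y (T \<omega>) \<omega>)) u = (CLINT \<omega>|M. char law1 (u * T \<omega> powr H))"
proof (rule LIMSEQ_unique)
  have [measurable]: "(\<lambda>\<omega>. Y (grid_above m (T \<omega>)) \<omega>) \<in> borel_measurable M" for m
    by (rule grid_measurable)
  have "(\<lambda>m. (CLINT \<omega>|M. iexp (u * Y (grid_above m (T \<omega>)) \<omega>))) \<longlonglongrightarrow> (CLINT \<omega>|M. iexp (u * Y (T \<omega>) \<omega>))"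
  proof (rule integral_dominated_convergence[where w="\<lambda>_. 1"])
    show "AE \<omega> in M. (\<lambda>m. iexp (u * Y (grid_above m (T \<omega>)) \<omega>)) \<longlonglongrightarrow> iexp (u * Y (T \<omega>) \<omega>)"
      by (intro AE_I2 tendsto_intros grid_tendsto)
  qed auto
  then show "(\<lambda>m. (CLINT \<omega>|M. iexp (u * Y (grid_above m (T \<omega>)) \<omega>))) \<longlonglongrightarrow> char (distr M borel (\<lambda>\<omega>. Y (T \<omega>) \<omega>)) u"
    by (simp add: char_def integral_distr)
  show "(\<lambda>m. (CLINT \<omega>|M. iexp (u * Y (grid_above m (T \<omega>)) \<omega>))) \<longlonglongrightarrow> (CLINT \<omega>|M. char law1 (u * T \<omega> powr H))"
    unfolding char_grid
  proof (rule integral_dominated_convergence[where w="\<lambda>_. 1"])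
    show "AE \<omega> in M. (\<lambda>m. char law1 (u * grid_above m (T \<omega>) powr H)) \<longlonglongrightarrow> char law1 (u * T \<omega> powr H)"
    proof (intro AE_I2 isCont_tendsto_compose[OF law1.isCont_char] tendsto_mult tendsto_const)
      fix \<omega> assume w: "\<omega> \<in> space M"
      show "(\<lambda>m. grid_above m (T \<omega>) powr H) \<longlonglongrightarrow> T \<omega> powr H"
        \<comment> \<open>Where \<open>T \<omega> = 0\<close> the base tends to 0 and the limit
          relies on \<open>H > 0\<close> together with nonnegative grid points.\<close>
        by (rule tendsto_powr'[OF grid_above_tendsto(1)[OF T_nonneg[OF w]] tendsto_const])
           (use H grid_above_bounds(1)[OF T_nonneg[OF w]] T_nonneg[OF w] in
             \<open>auto intro!: always_eventually less_imp_le intro: le_less_trans\<close>)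
    qed
  qed (auto simp: law1.cmod_char_le_1 grid_above_def)
qed

text \<open>Working with characteristic functions keeps every integrand bounded, so the limits and
  the use of Fubini need no moment condition. The complex power moments, whose integrands may be
  unbounded, are then computed from the product law.\<close>

lemma law_stopped:
  "distr M borel (\<lambda>\<omega>. Y (T \<omega>) \<omega>) =
   distr (distr M borel T \<Otimes>\<^sub>M law1) borel (\<lambda>(t, y). t powr H * y)"
proof (rule Levy_uniqueness)
  interpret LT: prob_space "distr M borel T" by (rule prob_space_distr) simp
  interpret P: pair_prob_space "distr M borel T" law1 ..
  show "real_distribution (distr M borel (\<lambda>\<omega>. Y (T \<omega>) \<omega>))"
    by (rule real_distribution_distr) simp
  show "real_distribution (distr (distr M borel T \<Otimes>\<^sub>M law1) borel (\<lambda>(t, y). t powr H * y))"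
    by (rule P.real_distribution_distr) simp
  show "char (distr M borel (\<lambda>\<omega>. Y (T \<omega>) \<omega>)) =
      char (distr (distr M borel T \<Otimes>\<^sub>M law1) borel (\<lambda>(t, y). t powr H * y))"
  proof
    fix u
    have int: "integrable (distr M borel T \<Otimes>\<^sub>M law1) (\<lambda>(t, y). iexp (u * (t powr H * y)))"
      by (rule P.integrable_const_bound[where B=1]) (auto simp: split_beta)
    have "char (distr (distr M borel T \<Otimes>\<^sub>M law1) borel (\<lambda>(t, y). t powr H * y)) u
        = (CLINT p|distr M borel T \<Otimes>\<^sub>M law1. (\<lambda>(t, y). iexp (u * (t powr H * y))) p)"
      unfolding char_def by (subst integral_distr) (simp_all add: case_prod_beta')
    also have "\<dots> = (CLINT t|distr M borel T. CLINT y|law1. iexp (u * (t powr H * y)))"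
      by (rule P.integral_fst[OF int, symmetric])
    also have "\<dots> = (CLINT t|distr M borel T. char law1 (u * t powr H))"
      unfolding char_def by (simp add: mult_ac)
    also have "\<dots> = (CLINT \<omega>|M. char law1 (u * T \<omega> powr H))"
      by (rule integral_distr) measurable
    also have "\<dots> = char (distr M borel (\<lambda>\<omega>. Y (T \<omega>) \<omega>)) u"
      by (rule char_stopped[symmetric])
    finally show "char (distr M borel (\<lambda>\<omega>. Y (T \<omega>) \<omega>)) u =
      char (distr (distr M borel T \<Otimes>\<^sub>M law1) borel (\<lambda>(t, y). t powr H * y)) u" ..
  qed
qed

end

subsection \<open>Expectation of the estimator\<close>

lemma distributed_mellin:
  fixes f :: "real \<Rightarrow> real"
  assumes dens: "distributed M lborel Z (\<lambda>x. ennreal (f x))" and f: "\<And>x. 0 \<le> f x"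
    and Z: "\<And>\<omega>. \<omega> \<in> space M \<Longrightarrow> 0 \<le> Z \<omega>"
    and int: "set_integrable lborel {0<..} (\<lambda>x. complex_of_real (f x) * complex_of_real (x powr (Re s - 1)))"
  shows "integrable M (\<lambda>\<omega>. complex_of_real (Z \<omega>) powr (s - 1))"
    and "(CLINT \<omega>|M. complex_of_real (Z \<omega>) powr (s - 1)) = mellin (\<lambda>x. complex_of_real (f x)) s"
proof -
  \<comment> \<open>The absolute value changes nothing on the half-line but gives a form covered by
    the measurability rule. Cutting off at 0 agrees with the convention that every power of 0 is 0,
    so an outcome with \<open>Z \<omega> = 0\<close> is treated consistently.\<close>
  define k where "k x = indicator {0<..} x *\<^sub>R (complex_of_real \<bar>x\<bar> powr (s - 1))" for x :: real
  have [measurable]: "k \<in> borel_measurable borel" unfolding k_def by measurable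
  have [measurable]: "Z \<in> borel_measurable M" using distributed_measurable[OF dens] by simp
  have [measurable]: "f \<in> borel_measurable borel"
    using distributed_real_measurable[OF _ dens] f by simp
  have kZ: "complex_of_real (Z \<omega>) powr (s - 1) = k (Z \<omega>)" if "\<omega> \<in> space M" for \<omega>
    using Z[OF that] by (cases "Z \<omega> = 0") (auto simp: k_def)
  have fk: "f x *\<^sub>R k x = indicator {0<..} x *\<^sub>R (complex_of_real (f x) * complex_of_real x powr (s - 1))" for x
    by (auto simp: k_def indicator_def scaleR_conv_of_real)
  have D: "distr M lborel Z = density lborel (\<lambda>x. ennreal (f x))"
    using distributed_distr_eq_density[OF dens] .
  have "integrable lborel (\<lambda>x. f x *\<^sub>R k x)"
    using set_integrable_mellin[OF int] unfolding fk set_integrable_def .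
  then have "integrable (distr M lborel Z) k"
    unfolding D by (subst integrable_density) (use f in auto)
  then have "integrable M (\<lambda>\<omega>. k (Z \<omega>))"
    by (subst (asm) integrable_distr_eq) auto
  then show "integrable M (\<lambda>\<omega>. complex_of_real (Z \<omega>) powr (s - 1))"
    using kZ by (simp cong: Bochner_Integration.integrable_cong)
  have "(CLINT \<omega>|M. complex_of_real (Z \<omega>) powr (s - 1)) = (CLINT \<omega>|M. k (Z \<omega>))"
    using kZ by (intro Bochner_Integration.integral_cong) auto
  also have "\<dots> = integral\<^sup>L (distr M lborel Z) k"
    by (subst integral_distr) auto
  also have "\<dots> = (CLINT x|lborel. f x *\<^sub>R k x)"
    unfolding D by (subst integral_density) (use f in auto)
  also have "\<dots> = mellin (\<lambda>x. complex_of_real (f x)) s"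
    unfolding fk mellin_def set_lebesgue_integral_def ..
  finally show "(CLINT \<omega>|M. complex_of_real (Z \<omega>) powr (s - 1)) = mellin (\<lambda>x. complex_of_real (f x)) s" .
qed

text \<open>Complex powers are not multiplicative in general because of the branch of
  \<open>Ln\<close>; for nonnegative reals the logarithms add, and a zero factor makes both sides
  0.\<close>

lemma of_real_powr_mult:
  "0 \<le> x \<Longrightarrow> 0 \<le> y \<Longrightarrow> complex_of_real (x * y) powr w = complex_of_real x powr w * complex_of_real y powr w"
  by (simp add: of_real_powr_eq ln_mult ring_distribs exp_add del: of_real_mult)

lemma of_real_powr_powr:
  assumes "0 \<le> t"
  shows "complex_of_real (t powr h) powr w = complex_of_real t powr (of_real h * w)"
  using assms by (cases "t = 0") (auto simp: of_real_powr_eq ln_powr mult_ac)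

lemma (in pair_sigma_finite) integrable_mult_pair:
  fixes f :: "'a \<Rightarrow> complex" and g :: "'b \<Rightarrow> complex"
  assumes f: "integrable M1 f" and g: "integrable M2 g"
  shows "integrable (M1 \<Otimes>\<^sub>M M2) (\<lambda>(x, y). f x * g y)"
    and "integral\<^sup>L (M1 \<Otimes>\<^sub>M M2) (\<lambda>(x, y). f x * g y) = integral\<^sup>L M1 f * integral\<^sup>L M2 g"
proof -
  note [measurable] = borel_measurable_integrable[OF f] borel_measurable_integrable[OF g]
  show int: "integrable (M1 \<Otimes>\<^sub>M M2) (\<lambda>(x, y). f x * g y)"
  proof (rule Fubini_integrable)
    show "integrable M1 (\<lambda>x. \<integral>y. norm (case (x, y) of (x, y) \<Rightarrow> f x * g y) \<partial>M2)"
      using f by (simp add: norm_mult)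
    show "AE x in M1. integrable M2 (\<lambda>y. case (x, y) of (x, y) \<Rightarrow> f x * g y)"
      using g by simp
  qed measurable
  show "integral\<^sup>L (M1 \<Otimes>\<^sub>M M2) (\<lambda>(x, y). f x * g y) = integral\<^sup>L M1 f * integral\<^sup>L M2 g"
    unfolding integral_fst[OF int, symmetric] by simp
qed

text \<open>The variable \<open>Z\<close> is any one with the law of the stopped process, so that
  the factorisation applies to each observation. Taking absolute values and powers splits
  \<open>t powr H * y\<close> into a function of \<open>t\<close> times a function of
  \<open>y\<close>, and the product measure separates the integrals.\<close>

lemma (in stopped_self_similar) stopped_abs_powr:
  assumes iT: "integrable M (\<lambda>\<omega>. complex_of_real (T \<omega>) powr (of_real H * w))"
    and iY: "integrable M (\<lambda>\<omega>. complex_of_real \<bar>Y 1 \<omega>\<bar> powr w)"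
    and [measurable]: "Z \<in> borel_measurable M" and Z: "distr M borel Z = distr M borel (\<lambda>\<omega>. Y (T \<omega>) \<omega>)"
  shows "integrable M (\<lambda>\<omega>. complex_of_real \<bar>Z \<omega>\<bar> powr w)"
    and "(CLINT \<omega>|M. complex_of_real \<bar>Z \<omega>\<bar> powr w) =
      (CLINT \<omega>|M. complex_of_real (T \<omega>) powr (of_real H * w)) * (CLINT \<omega>|M. complex_of_real \<bar>Y 1 \<omega>\<bar> powr w)"
proof -
  interpret LT: prob_space "distr M borel T" by (rule prob_space_distr) simp
  interpret P: pair_prob_space "distr M borel T" law1 ..
  define p where "p y = complex_of_real \<bar>y\<bar> powr w" for y :: real
  have [measurable]: "p \<in> borel_measurable borel" unfolding p_def by measurable
  have T: "p (T \<omega> powr H) = complex_of_real (T \<omega>) powr (of_real H * w)" if "\<omega> \<in> space M" for \<omega>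
    using of_real_powr_powr[OF T_nonneg[OF that]] by (simp add: p_def)
  have pmult: "p (t powr H * y) = p (t powr H) * p y" for t y
    unfolding p_def abs_mult by (rule of_real_powr_mult) auto
  have iT': "integrable (distr M borel T) (\<lambda>t. p (t powr H))"
    using iT T by (subst integrable_distr_eq) (auto cong: Bochner_Integration.integrable_cong)
  have iY': "integrable law1 p"
    using iY by (subst integrable_distr_eq) (auto simp: p_def)
  note pm = P.integrable_mult_pair[OF iT' iY']
  have iZ: "integrable (distr M borel Z) p"
    unfolding Z law_stopped
    by (subst integrable_distr_eq) (use pm(1) in \<open>auto simp: case_prod_beta' pmult\<close>)
  then show "integrable M (\<lambda>\<omega>. complex_of_real \<bar>Z \<omega>\<bar> powr w)"
    by (subst (asm) integrable_distr_eq) (auto simp: p_def)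
  have "(CLINT \<omega>|M. complex_of_real \<bar>Z \<omega>\<bar> powr w) = integral\<^sup>L (distr M borel Z) p"
    by (subst integral_distr) (auto simp: p_def)
  also have "\<dots> = integral\<^sup>L (distr M borel T \<Otimes>\<^sub>M law1) (\<lambda>(t, y). p (t powr H) * p y)"
    unfolding Z law_stopped
    by (subst integral_distr) (auto simp: case_prod_beta' pmult)
  also have "\<dots> = (CLINT t|distr M borel T. p (t powr H)) * integral\<^sup>L law1 p"
    by (rule pm(2))
  also have "(CLINT t|distr M borel T. p (t powr H)) = (CLINT \<omega>|M. complex_of_real (T \<omega>) powr (of_real H * w))"
    by (subst integral_distr) (auto intro!: Bochner_Integration.integral_cong simp: T)
  also have "integral\<^sup>L law1 p = (CLINT \<omega>|M. complex_of_real \<bar>Y 1 \<omega>\<bar> powr w)"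
    by (subst integral_distr) (auto simp: p_def)
  finally show "(CLINT \<omega>|M. complex_of_real \<bar>Z \<omega>\<bar> powr w) =
      (CLINT \<omega>|M. complex_of_real (T \<omega>) powr (of_real H * w)) * (CLINT \<omega>|M. complex_of_real \<bar>Y 1 \<omega>\<bar> powr w)" .
qed

text \<open>Fubini applies because \<open>Re (s v)\<close> is constant along the line: the integrand
  is dominated by \<open>\<bar>X k \<omega>\<bar> powr (p - 1)\<close> times
  \<open>cmod (q v)\<close>, an integrable product of a function of \<open>\<omega>\<close> and a
  function of \<open>v\<close>.\<close>

lemma expectation_empirical_integral:
  fixes X :: "nat \<Rightarrow> 'a \<Rightarrow> real" and s q :: "real \<Rightarrow> complex"
  assumes M: "prob_space M" and X[measurable]: "\<And>k. X k \<in> borel_measurable M"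
    and s: "continuous_on UNIV s" "\<And>v. Re (s v) = p"
    and q: "continuous_on {-g..g} q"
    and int: "\<And>k. integrable M (\<lambda>\<omega>. \<bar>X k \<omega>\<bar> powr (p - 1))"
    and mom: "\<And>k v. (CLINT \<omega>|M. complex_of_real \<bar>X k \<omega>\<bar> powr (s v - 1)) = m v" and n: "n \<ge> 1"
  shows "(CLINT \<omega>|M. CLBINT v:{-g..g}. emp_mellin X n \<omega> (s v) * q v) = (CLBINT v:{-g..g}. m v * q v)"
proof -
  interpret prob_space M by fact
  interpret P: pair_sigma_finite M lborel ..
  have [measurable]: "s \<in> borel_measurable borel" by (rule borel_measurable_continuous_onI[OF s(1)])
  define r where "r v = indicator {-g..g} v *\<^sub>R q v" for v
  have r: "integrable lborel r"
    using borel_integrable_compact[OF _ q] by (simp add: r_def[abs_def] set_integrable_def)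
  note [measurable] = borel_measurable_integrable[OF r]
  define \<Phi> where "\<Phi> k \<omega> v = complex_of_real \<bar>X k \<omega>\<bar> powr (s v - 1) * r v" for k \<omega> v
  have norm\<Phi>: "norm (\<Phi> k \<omega> v) = \<bar>X k \<omega>\<bar> powr (p - 1) * norm (r v)" for k \<omega> v
    by (simp add: \<Phi>_def norm_mult norm_of_real_powr s)
  have m\<Phi>[measurable]: "case_prod (\<Phi> k) \<in> borel_measurable (M \<Otimes>\<^sub>M lborel)" for k
    unfolding \<Phi>_def by measurable
  have int\<Phi>: "integrable (M \<Otimes>\<^sub>M lborel) (case_prod (\<Phi> k))" for k
  proof (rule P.Fubini_integrable)
    show "integrable M (\<lambda>\<omega>. \<integral>v. norm (case_prod (\<Phi> k) (\<omega>, v)) \<partial>lborel)"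
      using int by (simp add: norm\<Phi>)
    show "AE \<omega> in M. integrable lborel (\<lambda>v. case_prod (\<Phi> k) (\<omega>, v))"
    proof (rule AE_I2)
      fix \<omega> assume [measurable]: "\<omega> \<in> space M"
      have "integrable lborel (\<lambda>v. \<bar>X k \<omega>\<bar> powr (p - 1) * norm (r v))"
        using r by simp
      moreover have "(\<lambda>v. \<Phi> k \<omega> v) \<in> borel_measurable lborel"
        unfolding \<Phi>_def by measurable
      ultimately show "integrable lborel (\<lambda>v. case_prod (\<Phi> k) (\<omega>, v))"
        unfolding case_prod_conv by (rule Bochner_Integration.integrable_bound) (auto simp: norm\<Phi>)
    qed
  qed simp
  have E\<Phi>: "(CLINT \<omega>|M. \<Phi> k \<omega> v) = m v * r v" for k v
    unfolding \<Phi>_def by (simp add: mom)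
  have int_v: "integrable M (\<lambda>\<omega>. \<Phi> k \<omega> v)" for k v
  proof (rule Bochner_Integration.integrable_bound)
    show "integrable M (\<lambda>\<omega>. \<bar>X k \<omega>\<bar> powr (p - 1) * norm (r v))" using int by simp
  qed (auto simp: norm\<Phi>)
  define \<Psi> where "\<Psi> \<omega> v = (1 / of_nat n) * (\<Sum>k=1..n. \<Phi> k \<omega> v)" for \<omega> v
  have int\<Psi>: "integrable (M \<Otimes>\<^sub>M lborel) (case_prod \<Psi>)"
  proof -
    have "case_prod \<Psi> = (\<lambda>z. (1 / of_nat n) * (\<Sum>k=1..n. case_prod (\<Phi> k) z))"
      by (auto simp: \<Psi>_def)
    then show ?thesis
      by (simp only:) (intro integrable_mult_right Bochner_Integration.integrable_sum int\<Phi>)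
  qed
  have \<Psi>_eq: "indicator {-g..g} v *\<^sub>R (emp_mellin X n \<omega> (s v) * q v) = \<Psi> \<omega> v" for \<omega> v
    by (simp add: \<Psi>_def \<Phi>_def emp_mellin_def r_def scaleR_conv_of_real flip: sum_distrib_right)
  have "(CLINT \<omega>|M. CLBINT v:{-g..g}. emp_mellin X n \<omega> (s v) * q v) = (CLINT \<omega>|M. CLINT v|lborel. \<Psi> \<omega> v)"
    unfolding set_lebesgue_integral_def \<Psi>_eq ..
  also have "\<dots> = (CLINT v|lborel. CLINT \<omega>|M. \<Psi> \<omega> v)"
    by (rule P.Fubini_integral[OF int\<Psi>, symmetric])
  also have "\<dots> = (CLINT v|lborel. m v * r v)"
  proof (rule Bochner_Integration.integral_cong[OF refl])
    fix v
    have "(CLINT \<omega>|M. \<Psi> \<omega> v) = (1 / of_nat n) * (\<Sum>k=1..n. (CLINT \<omega>|M. \<Phi> k \<omega> v))"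
      unfolding \<Psi>_def
      by (subst integral_mult_right_zero, subst Bochner_Integration.integral_sum) (auto intro: int_v)
    \<comment> \<open>The \<open>n\<close> equal summands cancel the factor \<open>1 / n\<close>;
      for \<open>n = 0\<close> that factor would be 0.\<close>
    then show "(CLINT \<omega>|M. \<Psi> \<omega> v) = m v * r v" using n by (simp add: E\<Phi>)
  qed
  also have "\<dots> = (CLBINT v:{-g..g}. m v * q v)"
    by (simp add: set_lebesgue_integral_def r_def scaleR_conv_of_real mult_ac)
  finally show ?thesis .
qed

theorem theorem6:
  fixes M :: "'a measure" and Y :: "real \<Rightarrow> 'a \<Rightarrow> real" and H :: real
    and T :: "'a \<Rightarrow> real" and fT :: "real \<Rightarrow> real" and f1 :: "real \<Rightarrow> real"
    and X :: "nat \<Rightarrow> 'a \<Rightarrow> real" and g :: "nat \<Rightarrow> real"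
    and \<beta> a b \<gamma> :: real
  assumes P: "prob_space M"
    and H: "H > 0"
    and Y_rv: "\<And>t. t \<ge> 0 \<Longrightarrow> Y t \<in> borel_measurable M"
    and Y_cadlag: "\<And>\<omega>. \<omega> \<in> space M \<Longrightarrow> cadlag (\<lambda>t. Y t \<omega>)"
    and Y_ss: "self_similar M Y H"
    and f1_nonneg: "\<And>x. f1 x \<ge> 0"
    and f1_dens: "distributed M lborel (\<lambda>\<omega>. \<bar>Y 1 \<omega>\<bar>) (\<lambda>x. ennreal (f1 x))"
    and f1_class: "mellin_class {0<..} (\<lambda>x. complex_of_real (f1 x))"
    and T_nonneg: "\<And>\<omega>. \<omega> \<in> space M \<Longrightarrow> T \<omega> \<ge> 0"
    and fT_nonneg: "\<And>x. fT x \<ge> 0"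
    and fT_dens: "distributed M lborel T (\<lambda>x. ennreal (fT x))"
    and T_indep: "prob_space.indep_set M
                 (sigma_sets (space M) {T -` A \<inter> space M | A. A \<in> sets borel})
                 (sigma_sets (space M) (\<Union>t\<in>{0..}. {Y t -` A \<inter> space M | A. A \<in> sets borel}))"
    and X_indep: "prob_space.indep_vars M (\<lambda>_. borel) X UNIV"
    and X_distr: "\<And>k. distr M borel (X k) = distr M borel (\<lambda>\<omega>. Y (T \<omega>) \<omega>)"
    and g_pos: "\<And>n. g n > 0"
    and g_lim: "filterlim g at_top sequentially"
    and \<beta>: "0 < \<beta>" "\<beta> < pi"
    and ab: "0 \<le> a" "a < b"
    and fT_class: "sector_class \<beta> a b (\<lambda>x. complex_of_real (fT x))"
    and \<gamma>: "max a (1 - H) < \<gamma>" "\<gamma> < b"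
    and nonvanish: "\<And>v. mellin (\<lambda>x. complex_of_real (f1 x))
                        ((complex_of_real (\<gamma> + H - 1) + \<i> * of_real v) / of_real H) \<noteq> 0"
  shows "\<exists>C>0. \<forall>x>0. \<forall>n\<ge>1.
           cmod (complex_of_real (fT x)
                 - integral\<^sup>L M (estimator X (\<lambda>x. complex_of_real (f1 x)) H \<gamma> g n x))
             \<le> C * x powr (- \<gamma>) * exp (- \<beta> * g n)"
proof -
  let ?f = "\<lambda>x. complex_of_real (fT x)" and ?f1 = "\<lambda>x. complex_of_real (f1 x)"
  have T_rv: "T \<in> borel_measurable M" using distributed_measurable[OF fT_dens] by simp
  interpret prob_space M by (rule P)
  interpret stopped_self_similar M Y H T
    by unfold_locales (use H Y_rv Y_cadlag Y_ss T_rv T_nonneg T_indep in auto)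
  have \<gamma>': "a < \<gamma>" "\<gamma> < b" "1 - H < \<gamma>" using \<gamma> by auto
  \<comment> \<open>This is the common real part of the arguments at which the transform of
    \<open>f1\<close> is evaluated; \<open>\<gamma> > 1 - H\<close> makes it positive.\<close>
  define p where "p = (\<gamma> + H - 1) / H"
  have p: "p > 0" using \<gamma>' H by (simp add: p_def)
  define s where "s v = (complex_of_real (\<gamma> + H - 1) + \<i> * of_real v) / of_real H" for v
  have s_eq: "s v = Complex p (v / H)" for v
    using H by (simp add: s_def p_def complex_eq_iff)
  \<comment> \<open>This identity explains the choice of \<open>s\<close>: raising
    \<open>T powr H\<close> to the power \<open>s v - 1\<close> yields exactly the Mellin kernel of
    \<open>fT\<close> at \<open>\<gamma> + iv\<close>.\<close>
  have Hs: "of_real H * (s v - 1) = Complex \<gamma> v - 1" for v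
    using H by (simp add: s_eq p_def complex_eq_iff field_simps)
  have siT: "set_integrable lborel {0<..} (\<lambda>x. ?f x * complex_of_real (x powr (\<gamma> - 1)))"
    using fT_class \<gamma>' by (auto simp: sector_class_def mellin_class_def)
  have si1: "set_integrable lborel {0<..} (\<lambda>x. ?f1 x * complex_of_real (x powr (p - 1)))"
    using f1_class p by (auto simp: mellin_class_def)
  have mT: "integrable M (\<lambda>\<omega>. complex_of_real (T \<omega>) powr (of_real H * (s v - 1)))"
      "(CLINT \<omega>|M. complex_of_real (T \<omega>) powr (of_real H * (s v - 1))) = mellin ?f (Complex \<gamma> v)" for v
    unfolding Hs using distributed_mellin[OF fT_dens fT_nonneg T_nonneg, of "Complex \<gamma> v"] siT by auto
  have m1: "integrable M (\<lambda>\<omega>. complex_of_real \<bar>Y 1 \<omega>\<bar> powr (s v - 1))"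
      "(CLINT \<omega>|M. complex_of_real \<bar>Y 1 \<omega>\<bar> powr (s v - 1)) = mellin ?f1 (s v)" for v
    using distributed_mellin[OF f1_dens f1_nonneg, of "s v"] si1 by (auto simp: s_eq)
  have X_rv: "X k \<in> borel_measurable M" for k
    using X_indep by (simp add: indep_vars_def)
  note mX = stopped_abs_powr[OF mT(1) m1(1) X_rv X_distr, unfolded mT(2) m1(2)]
  \<comment> \<open>One point of the line suffices, since the modulus of the power depends only on
    the real part \<open>p\<close>.\<close>
  have X_int: "integrable M (\<lambda>\<omega>. \<bar>X k \<omega>\<bar> powr (p - 1))" for k
    using integrable_norm[OF mX(1)[of k 0]] by (simp add: norm_of_real_powr s_eq)
  have s_cont: "continuous_on UNIV s" unfolding s_def using H by (auto intro!: continuous_intros)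
  have m1_cont: "continuous_on UNIV (\<lambda>v. mellin ?f1 (s v))"
    unfolding s_eq
    by (rule continuous_on_compose2[OF continuous_at_imp_continuous_on[of UNIV "\<lambda>v. mellin ?f1 (Complex p v)"]])
       (use isCont_mellin_vertical[OF si1] H in \<open>auto intro!: continuous_intros\<close>)
  have bias: "integral\<^sup>L M (estimator X ?f1 H \<gamma> g n x) = 1 / (2 * pi) *
      (CLBINT v:{- g n..g n}. mellin ?f (Complex \<gamma> v) * complex_of_real x powr (- Complex \<gamma> v))"
    if x: "x > 0" and n: "n \<ge> 1" for x n
  proof -
    \<comment> \<open>The deterministic part of the integrand is collected here; it is continuous
      because the denominator is continuous in \<open>v\<close> and does not vanish, hence
      integrable over the compact interval.\<close>
    define q where "q v = complex_of_real x powr (- Complex \<gamma> v) / mellin ?f1 (s v)" for v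
    have nz: "mellin ?f1 (s v) \<noteq> 0" for v unfolding s_def by (rule nonvanish)
    have xc: "continuous_on UNIV (\<lambda>v. complex_of_real x powr (- Complex \<gamma> v))"
      using x by (auto simp: of_real_powr_eq Complex_eq intro!: continuous_intros)
    have q_cont: "continuous_on {- g n..g n} q"
      unfolding q_def
      by (intro continuous_on_divide continuous_on_subset[OF xc] continuous_on_subset[OF m1_cont]) (use nz in auto)
    have est: "estimator X ?f1 H \<gamma> g n x \<omega> = 1 / (2 * pi) * (CLBINT v:{- g n..g n}. emp_mellin X n \<omega> (s v) * q v)" for \<omega>
      by (simp add: estimator_def Let_def q_def s_def Complex_eq)
    have "integral\<^sup>L M (estimator X ?f1 H \<gamma> g n x) =
        1 / (2 * pi) * (CLINT \<omega>|M. CLBINT v:{- g n..g n}. emp_mellin X n \<omega> (s v) * q v)"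
      unfolding est by (rule integral_mult_right_zero)
    also have "(CLINT \<omega>|M. CLBINT v:{- g n..g n}. emp_mellin X n \<omega> (s v) * q v) =
        (CLBINT v:{- g n..g n}. mellin ?f (Complex \<gamma> v) * mellin ?f1 (s v) * q v)"
      by (rule expectation_empirical_integral[OF P X_rv s_cont _ q_cont X_int mX(2) n]) (simp add: s_eq)
    also have "(\<lambda>v. mellin ?f (Complex \<gamma> v) * mellin ?f1 (s v) * q v) =
        (\<lambda>v. mellin ?f (Complex \<gamma> v) * complex_of_real x powr (- Complex \<gamma> v))"
      using nz by (simp add: q_def)
    finally show ?thesis .
  qed
  show ?thesis
  proof (rule mellin_inversion_tail[OF \<beta> fT_class \<gamma>'(1,2) fT_nonneg])
    fix C :: real
    assume C: "C > 0" "\<And>x g. x > 0 \<Longrightarrow> cmod (?f x - 1 / (2 * pi) *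
        (CLBINT v:{-g..g}. mellin ?f (Complex \<gamma> v) * complex_of_real x powr (- Complex \<gamma> v)))
      \<le> C * x powr (- \<gamma>) * exp (- \<beta> * g)"
    show ?thesis
    proof (intro exI[of _ C] conjI allI impI)
      fix x :: real and n :: nat
      assume "x > 0" "1 \<le> n"
      then show "cmod (?f x - integral\<^sup>L M (estimator X ?f1 H \<gamma> g n x)) \<le> C * x powr (- \<gamma>) * exp (- \<beta> * g n)"
        unfolding bias[OF \<open>x > 0\<close> \<open>1 \<le> n\<close>] by (intro C(2))
    qed (rule C(1))
  qed
qed

end
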